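(* Let $(\rho(\theta))_{\theta\in\mathbb{R}^L}$ be a second-order differentiable parameterized family of positive definite states (density operators) on a finite-dimensional Hilbert space. Then for all $\alpha\in(0,1)\cup(1,\infty)$ and all $\theta\in\mathbb{R}^L$, the log-Euclidean information matrix equals the Kubo--Mori information matrix: $$I_\alpha^\flat(\theta)=I_{\mathrm{KM}}(\theta).$$
   Context: A state is a positive semi-definite operator of unit trace. For positive definite states $\rho,\sigma$ and $\alpha\in(0,1)\cup(1,\infty)$, the log-Euclidean Rényi relative entropy is $D_\alpha^\flat(\rho\|\sigma):=\frac{1}{\alpha-1}\ln\mathrm{Tr}[\exp(\alpha\ln\rho+(1-\alpha)\ln\sigma)]$. The (Umegaki) quantum relative entropy is $D(\rho\|\sigma):=\mathrm{Tr}[\rho(\ln\rho-\ln\sigma)]$. The log-Euclidean information matrix $I_\alpha^\flat(\theta)$ is the $L\times L$ matrix with entries $[I_\alpha^\flat(\theta)]_{i,j}:=\frac{1}{\alpha}\left.\frac{\partial^2}{\partial\varepsilon_i\partial\varepsilon_j}D_\alpha^\flat(\rho(\theta)\|\rho(\theta+\varepsilon))\right|_{\varepsilon=0}$. The Kubo--Mori information matrix has entries $[I_{\mathrm{KM}}(\theta)]_{i,j}:=\left.\frac{\partial^2}{\partial\varepsilon_i\partial\varepsilon_j}D(\rho(\theta)\|\rho(\theta+\varepsilon))\right|_{\varepsilon=0}$; equivalently $[I_{\mathrm{KM}}(\theta)]_{i,j}=\sum_{k,\ell}f_{\ln}^{[1]}(\lambda_k,\lambda_\ell)\mathrm{Tr}[(\partial_i\rho(\theta))\Pi_k(\partial_j\rho(\theta))\Pi_\ell]$,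 where $\partial_i=\partial/\partial\theta_i$, $\rho(\theta)=\sum_k\lambda_k\Pi_k$ is a spectral decomposition, and $f_{\ln}^{[1]}(x,y)=\frac{\ln x-\ln y}{x-y}$ for $x\ne y$, $f_{\ln}^{[1]}(x,x)=\frac1x$. *)

theory Defs
  imports "HOL-Analysis.Analysis"
begin

text \<open>Operators on a finite-dimensional Hilbert space are complex square matrices
  \<^typ>\<open>complex^'d^'d\<close>, acting by \<^term>\<open>(*v)\<close>, with product \<^term>\<open>(**)\<close>.\<close>

definition cinner :: "complex^'d \<Rightarrow> complex^'d \<Rightarrow> complex" where
  "cinner v w = (\<Sum>i\<in>UNIV. cnj (v $ i) * w $ i)"

definition hermitian :: "complex^'d^'d \<Rightarrow> bool" where
  "hermitian A \<longleftrightarrow> (\<forall>i j. A $ i $ j = cnj (A $ j $ i))"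

definition pos_semidef :: "complex^'d^'d \<Rightarrow> bool" where
  "pos_semidef A \<longleftrightarrow> hermitian A \<and> (\<forall>v. 0 \<le> Re (cinner v (A *v v)))"

definition pos_def :: "complex^'d^'d \<Rightarrow> bool" where
  "pos_def A \<longleftrightarrow> hermitian A \<and> (\<forall>v. v \<noteq> 0 \<longrightarrow> 0 < Re (cinner v (A *v v)))"

definition state :: "complex^'d^'d \<Rightarrow> bool" where
  "state A \<longleftrightarrow> pos_semidef A \<and> trace A = 1"

text \<open>Functional calculus \<open>f(A) = \<Sum>\<^sub>k f(\<lambda>\<^sub>k) \<Pi>\<^sub>k\<close> for Hermitian \<open>A\<close>, where \<open>\<lambda>\<^sub>k\<close> are the
  distinct (hence real) eigenvalues and \<open>\<Pi>\<^sub>k\<close> the orthogonal projections onto the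
  eigenspaces.  These definitions are only meant to be used for Hermitian \<open>A\<close>.\<close>

definition eigenspace :: "complex^'d^'d \<Rightarrow> real \<Rightarrow> (complex^'d) set" where
  "eigenspace A l = {v. A *v v = l *\<^sub>R v}"

definition eigenvalues :: "complex^'d^'d \<Rightarrow> real set" where
  "eigenvalues A = {l. \<exists>v \<in> eigenspace A l. v \<noteq> 0}"

definition spectral_proj :: "complex^'d^'d \<Rightarrow> real \<Rightarrow> complex^'d^'d" where
  "spectral_proj A l =
     (THE P. hermitian P \<and> P ** P = P \<and> range (\<lambda>v. P *v v) = eigenspace A l)"

definition matrix_fun :: "(real \<Rightarrow> real) \<Rightarrow> complex^'d^'d \<Rightarrow> complex^'d^'d" where
  "matrix_fun f A = (\<Sum>l\<in>eigenvalues A. f l *\<^sub>R spectral_proj A l)"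

abbreviation matrix_exp :: "complex^'d^'d \<Rightarrow> complex^'d^'d" where
  "matrix_exp \<equiv> matrix_fun exp"

abbreviation matrix_ln :: "complex^'d^'d \<Rightarrow> complex^'d^'d" where
  "matrix_ln \<equiv> matrix_fun ln"

text \<open>The traces below are real for positive definite arguments, so \<^const>\<open>Re\<close> is only
  a coercion from \<^typ>\<open>complex\<close> to \<^typ>\<open>real\<close>.\<close>

definition log_euclidean_renyi :: "real \<Rightarrow> complex^'d^'d \<Rightarrow> complex^'d^'d \<Rightarrow> real" where
  "log_euclidean_renyi \<alpha> \<rho> \<sigma> =
     1 / (\<alpha> - 1) *
     ln (Re (trace (matrix_exp (\<alpha> *\<^sub>R matrix_ln \<rho> + (1 - \<alpha>) *\<^sub>R matrix_ln \<sigma>))))"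

definition umegaki :: "complex^'d^'d \<Rightarrow> complex^'d^'d \<Rightarrow> real" where
  "umegaki \<rho> \<sigma> = Re (trace (\<rho> ** (matrix_ln \<rho> - matrix_ln \<sigma>)))"

definition partial_deriv :: "'l::finite \<Rightarrow> (real^'l \<Rightarrow> real) \<Rightarrow> real^'l \<Rightarrow> real" where
  "partial_deriv i F x = deriv (\<lambda>t. F (x + t *\<^sub>R axis i 1)) 0"

definition log_euclidean_info ::
    "real \<Rightarrow> (real^'l \<Rightarrow> complex^'d^'d) \<Rightarrow> real^'l \<Rightarrow> real^'l^'l" where
  "log_euclidean_info \<alpha> \<rho> \<theta> =
     (\<chi> i j. 1 / \<alpha> *
        partial_deriv i (partial_deriv j
          (\<lambda>\<epsilon>. log_euclidean_renyi \<alpha> (\<rho> \<theta>) (\<rho> (\<theta> + \<epsilon>)))) 0)"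

definition kubo_mori_info :: "(real^'l \<Rightarrow> complex^'d^'d) \<Rightarrow> real^'l \<Rightarrow> real^'l^'l" where
  "kubo_mori_info \<rho> \<theta> =
     (\<chi> i j. partial_deriv i (partial_deriv j
        (\<lambda>\<epsilon>. umegaki (\<rho> \<theta>) (\<rho> (\<theta> + \<epsilon>)))) 0)"

text \<open>Twice differentiable everywhere (in the Frechet sense); the second derivative need not be
  continuous.\<close>

definition twice_differentiable ::
    "('a::real_normed_vector \<Rightarrow> 'b::real_normed_vector) \<Rightarrow> bool" where
  "twice_differentiable f \<longleftrightarrow>
     (\<exists>f' :: 'a \<Rightarrow> 'a \<Rightarrow>\<^sub>L 'b.
        (\<forall>x. (f has_derivative blinfun_apply (f' x)) (at x)) \<and>
        (\<forall>x. f' differentiable (at x)))"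

end

theory Submission
  imports Defs
begin

text \<open>Put \<open>K = ln \<circ> \<rho>\<close> and \<open>Z\<^sub>s(x) = Tr exp (K \<theta> + s (K x - K \<theta>))\<close>. Since the derivative of
  \<open>Tr exp\<close> at \<open>X\<close> in direction \<open>Y\<close> is \<open>Tr (exp X \<cdot> Y)\<close>, at \<open>\<theta>\<close> the first derivatives of \<open>Z\<^sub>s\<close> are
  \<open>s Tr (\<rho> \<partial>\<^sub>jK)\<close> and the second ones are \<open>s\<^sup>2 Q\<^sub>i\<^sub>j + s Tr (\<rho> \<partial>\<^sub>i\<partial>\<^sub>jK)\<close>, where
  \<open>Q\<^sub>i\<^sub>j = Tr (Dexp(K \<theta>)[\<partial>\<^sub>iK] \<partial>\<^sub>jK)\<close>. As \<open>Z\<^sub>1 = Tr \<rho> = 1\<close> identically, \<open>Tr (\<rho> \<partial>\<^sub>jK) = 0\<close> and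
  \<open>Tr (\<rho> \<partial>\<^sub>i\<partial>\<^sub>jK) = - Q\<^sub>i\<^sub>j\<close>. Hence \<open>\<partial>\<^sub>i\<partial>\<^sub>j ln Z\<^sub>s = s (s - 1) Q\<^sub>i\<^sub>j\<close>, which for \<open>s = 1 - \<alpha>\<close> gives the
  log-Euclidean information \<open>Q\<^sub>i\<^sub>j\<close>, and the Umegaki relative entropy \<open>- Tr (\<rho> (K x - K \<theta>))\<close>
  has the same Hessian. Smoothness of \<open>exp\<close> and \<open>ln\<close> comes from power series in \<open>X\<close>: near a
  positive definite \<open>A\<close> a large \<open>c\<close> makes the operator norm of \<open>A/c - 1\<close> less than 1.\<close>

section \<open>Spectral theorem and functional calculus\<close>

text \<open>Rayleigh quotient argument: if the eigenvectors did not span, their orthogonal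
  complement \<open>W\<close> would be a nonzero invariant subspace. A maximizer of
  \<open>f v \<bullet> v\<close> on its unit sphere is an eigenvector lying in \<open>W\<close>,
  hence orthogonal to itself.\<close>

lemma selfadjoint_spectral_span:
  fixes f :: "'a::euclidean_space \<Rightarrow> 'a"
  assumes lin: "linear f" and sa: "\<And>x y. f x \<bullet> y = x \<bullet> f y"
  shows "span {v. \<exists>l. f v = l *\<^sub>R v} = UNIV"
proof (rule ccontr)
  let ?E = "{v. \<exists>l. f v = l *\<^sub>R v}"
  interpret f: linear f by fact
  define W where "W = {w. \<forall>e\<in>?E. e \<bullet> w = 0}"
  assume "span ?E \<noteq> UNIV"
  then obtain x where "x \<notin> span ?E" by blast
  moreover obtain y z where "y \<in> span ?E" "\<And>w. w \<in> span ?E \<Longrightarrow> orthogonal z w" "x = y + z"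
    using orthogonal_subspace_decomp_exists by blast
  ultimately have z: "z \<noteq> 0" "z \<in> W"
    by (auto simp: W_def orthogonal_def inner_commute intro: span_base)
  have W_inv: "f w \<in> W" if "w \<in> W" for w
    using that by (auto simp: W_def sa[symmetric])
  have W_sub: "subspace W"
    by (auto simp: W_def subspace_def inner_right_distrib)
  have "closed W"
    by (rule closed_subspace[OF W_sub])
  then have comp: "compact (sphere 0 1 \<inter> W)"
    by (intro compact_Int_closed) auto
  have "z /\<^sub>R norm z \<in> sphere 0 1 \<inter> W"
    using z W_sub by (simp add: subspace_scale)
  then have ne: "sphere 0 1 \<inter> W \<noteq> {}" by blast
  have "continuous_on (sphere 0 1 \<inter> W) (\<lambda>v. f v \<bullet> v)"
    using lin by (intro continuous_intros linear_continuous_on linear_conv_bounded_linear[THEN iffD1])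
  from continuous_attains_sup[OF comp ne this]
  obtain u where u: "u \<in> W" "norm u = 1"
    and max: "\<And>v. v \<in> W \<Longrightarrow> norm v = 1 \<Longrightarrow> f v \<bullet> v \<le> f u \<bullet> u" by auto
  define m where "m = f u \<bullet> u"
  have le: "f v \<bullet> v \<le> m * (v \<bullet> v)" if "v \<in> W" for v
  proof (cases "v = 0")
    case False
    have "f (v /\<^sub>R norm v) \<bullet> (v /\<^sub>R norm v) \<le> m"
      unfolding m_def using False that W_sub by (intro max) (auto simp: subspace_scale)
    then have "(f v \<bullet> v) / (norm v)\<^sup>2 \<le> m"
      by (simp add: f.scaleR power2_eq_square field_simps)
    then show ?thesis
      using False by (simp add: divide_le_eq power2_norm_eq_inner)
  qed (simp add: f.zero)
  \<comment> \<open>\<open>g\<close> is the residual of the eigenvalue equation at the maximizer.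
    Moving \<open>u\<close> in the direction \<open>g\<close> would raise the quotient to first
    order unless \<open>g = 0\<close>.\<close>
  define g where "g = f u - m *\<^sub>R u"
  have g: "g \<in> W"
    unfolding g_def using u W_inv W_sub by (simp add: subspace_diff subspace_scale)
  \<comment> \<open>Insert \<open>u + t *\<^sub>R g\<close> into \<open>le\<close>, cancel the
    zeroth-order terms and divide by t; the limit t to 0 from the right then forces
    \<open>g = 0\<close>.\<close>
  have "2 * (g \<bullet> g) \<le> t * (m * (g \<bullet> g) - f g \<bullet> g)" if t: "t > 0" for t
  proof -
    have uu: "u \<bullet> u = 1" using u by (simp add: norm_eq_sqrt_inner)
    have "u + t *\<^sub>R g \<in> W"
      using u g W_sub by (simp add: subspace_add subspace_scale)
    from le[OF this] have "m + 2 * t * (f u \<bullet> g) + t * t * (f g \<bullet> g)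
        \<le> m + 2 * t * m * (u \<bullet> g) + m * (t * t * (g \<bullet> g))"
      using sa[of g u]
      by (simp add: f.add f.scaleR inner_add_left inner_add_right uu m_def inner_commute algebra_simps)
    moreover have "f u \<bullet> g - m * (u \<bullet> g) = g \<bullet> g"
      by (simp add: g_def inner_diff_left)
    ultimately have "t * (2 * (g \<bullet> g)) \<le> t * (t * (m * (g \<bullet> g) - f g \<bullet> g))"
      by (simp add: algebra_simps)
    then show ?thesis using t by simp
  qed
  then have "\<forall>\<^sub>F t in at_right 0. 2 * (g \<bullet> g) \<le> t * (m * (g \<bullet> g) - f g \<bullet> g)"
    by (simp add: eventually_at_right_less eventually_mono[OF eventually_at_right_less])
  moreover have "((\<lambda>t. t * (m * (g \<bullet> g) - f g \<bullet> g)) \<longlongrightarrow> 0 * (m * (g \<bullet> g) - f g \<bullet> g)) (at_right 0)"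
    by (intro tendsto_intros)
  ultimately have "2 * (g \<bullet> g) \<le> 0"
    using tendsto_lowerbound[of _ 0 "at_right (0::real)" "2 * (g \<bullet> g)"] by simp
  then have "g = 0"
    using inner_gt_zero_iff[of g] by linarith
  then have "u \<in> ?E" by (auto simp: g_def)
  then have "u \<bullet> u = 0" using u by (auto simp: W_def)
  then show False using u by auto
qed

section \<open>Hermitian matrices and their real eigenspaces\<close>

lemma inner_eq_Re_cinner: "v \<bullet> w = Re (cinner v w)"
  by (simp add: cinner_def inner_vec_def inner_complex_def)

lemma cinner_matrix_hermitian:
  assumes "hermitian A"
  shows "cinner (A *v v) w = cinner v (A *v w)"
proof -
  have h: "cnj (A $ i $ j) = A $ j $ i" for i j
    using assms unfolding hermitian_def by metis
  have "cinner (A *v v) w = (\<Sum>i\<in>UNIV. \<Sum>j\<in>UNIV. A $ j $ i * cnj (v $ j) * w $ i)"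
    by (simp add: cinner_def matrix_vector_mult_def sum_distrib_right h)
  also have "\<dots> = (\<Sum>j\<in>UNIV. \<Sum>i\<in>UNIV. A $ j $ i * cnj (v $ j) * w $ i)"
    by (rule sum.swap)
  also have "\<dots> = cinner v (A *v w)"
    by (simp add: cinner_def matrix_vector_mult_def sum_distrib_left mult_ac)
  finally show ?thesis .
qed

lemma cinner_axis: "cinner (axis i 1) w = w $ i" "cinner w (axis i 1) = cnj (w $ i)"
proof -
  have "cinner (axis i 1) w = (\<Sum>k\<in>UNIV. if k = i then w $ k else 0)"
    unfolding cinner_def by (intro sum.cong) (auto simp: axis_def)
  then show "cinner (axis i 1) w = w $ i" by simp
  have "cinner w (axis i 1) = (\<Sum>k\<in>UNIV. if k = i then cnj (w $ k) else 0)"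
    unfolding cinner_def by (intro sum.cong) (auto simp: axis_def)
  then show "cinner w (axis i 1) = cnj (w $ i)" by simp
qed

lemma matrix_vector_mult_axis: "((A :: complex^'d^'d) *v axis j 1) $ i = A $ i $ j"
proof -
  have "((A :: complex^'d^'d) *v axis j 1) $ i = (\<Sum>k\<in>UNIV. if k = j then A $ i $ k else 0)"
    unfolding matrix_vector_mult_def vec_lambda_beta by (intro sum.cong) (auto simp: axis_def)
  then show ?thesis by simp
qed

lemma hermitian_iff_cinner:
  "hermitian A \<longleftrightarrow> (\<forall>v w. cinner (A *v v) w = cinner v (A *v w))"
proof
  assume *: "\<forall>v w. cinner (A *v v) w = cinner v (A *v w)"
  show "hermitian A"
    unfolding hermitian_def
  proof safe
    fix i j
    have "cinner (A *v axis i 1) (axis j 1) = cinner (axis i 1) (A *v axis j 1)"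
      using * by blast
    then show "A $ i $ j = cnj (A $ j $ i)"
      by (simp add: cinner_axis matrix_vector_mult_axis)
  qed
qed (simp add: cinner_matrix_hermitian)

lemma inner_matrix_hermitian: "hermitian A \<Longrightarrow> (A *v v) \<bullet> w = v \<bullet> (A *v w)"
  by (simp add: inner_eq_Re_cinner cinner_matrix_hermitian)

lemma span_eigenspaces:
  fixes A :: "complex^'d^'d"
  assumes "hermitian A"
  shows "span {v. \<exists>l. v \<in> eigenspace A l} = UNIV"
  unfolding eigenspace_def mem_Collect_eq
  using assms by (intro selfadjoint_spectral_span) (auto simp: inner_matrix_hermitian)

text \<open>The eigenvectors of a Hermitian matrix span, so a matrix is determined by its action on
  them. Matrix functions are later identified with power series in this way.\<close>

lemma matrix_eqI_eigenspaces:
  fixes A M N :: "complex^'d^'d"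
  assumes "hermitian A" and eq: "\<And>l v. v \<in> eigenspace A l \<Longrightarrow> M *v v = N *v v"
  shows "M = N"
proof -
  have "M *v v = N *v v" for v
  proof (rule linear_eq_on_span[of "(*v) M" "(*v) N" "{v. \<exists>l. v \<in> eigenspace A l}"])
    show "v \<in> span {v. \<exists>l. v \<in> eigenspace A l}"
      by (simp add: span_eigenspaces[OF assms(1)])
  qed (auto intro: eq)
  then show ?thesis by (simp add: matrix_eq)
qed

lemma eigenspace_orthogonal:
  assumes "hermitian A" "v \<in> eigenspace A l" "w \<in> eigenspace A m" "l \<noteq> m"
  shows "v \<bullet> w = 0"
proof -
  have "l * (v \<bullet> w) = m * (v \<bullet> w)"
    using inner_matrix_hermitian[OF assms(1), of v w] assms(2,3) by (simp add: eigenspace_def)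
  then show ?thesis using \<open>l \<noteq> m\<close> by simp
qed

section \<open>Spectral projections and the functional calculus\<close>

lemma cinner_scaleC_right: "cinner v (c *s w) = c * cinner v w"
  by (simp add: cinner_def sum_distrib_left mult_ac)

text \<open>Makes the definite description in \<open>spectral_proj\<close> meaningful. The
  projection is built from the real orthogonal decomposition; closure of \<open>E\<close> under
  complex scalars makes it complex linear.\<close>

lemma complex_subspace_projection_ex1:
  fixes E :: "(complex^'d) set"
  assumes sub: "subspace E" and cplx: "\<And>c v. v \<in> E \<Longrightarrow> c *s v \<in> E"
  shows "\<exists>!P. hermitian P \<and> P ** P = P \<and> range ((*v) P) = E"
proof -
  have dec: "\<exists>p. p \<in> E \<and> (\<forall>w\<in>E. cinner w (v - p) = 0)" for v
  proof -
    obtain p z where *: "p \<in> span E" "\<And>w. w \<in> span E \<Longrightarrow> orthogonal z w" "v = p + z"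
      using orthogonal_subspace_decomp_exists by blast
    have span: "span E = E" using sub by (simp add: span_eq_iff)
    have "cinner w z = 0" if "w \<in> E" for w
    proof -
      \<comment> \<open>The decomposition gives orthogonality for the real inner product only.
        Applying it to the multiples of \<open>w\<close> by 1 and by the imaginary unit kills both
        parts of \<open>cinner w z\<close>.\<close>
      have "Re (cinner (c *s w) z) = 0" for c
        using *(2)[of "c *s w"] cplx[OF that, of c] span
        by (simp add: inner_eq_Re_cinner[symmetric] orthogonal_def inner_commute[of z])
      moreover have "cinner (c *s w) z = cnj c * cinner w z" for c
        by (simp add: cinner_def sum_distrib_left mult_ac)
      ultimately have "Re (cnj c * cinner w z) = 0" for c by metis
      from this[of 1] this[of \<i>] show ?thesis by (simp add: complex_eq_iff)
    qed
    then show ?thesis using * span by (intro exI[of _ p]) auto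
  qed
  define p where "p v = (SOME q. q \<in> E \<and> (\<forall>w\<in>E. cinner w (v - q) = 0))" for v
  have p: "p v \<in> E" "w \<in> E \<Longrightarrow> cinner w (v - p v) = 0" for v w
    using someI_ex[OF dec[of v]] unfolding p_def by auto
  have uniq: "q = p v" if "q \<in> E" "\<And>w. w \<in> E \<Longrightarrow> cinner w (v - q) = 0" for q v
  proof -
    \<comment> \<open>Both residuals \<open>v - q\<close> and \<open>v - p v\<close> are orthogonal
      to \<open>E\<close>, so \<open>q - p v\<close> is an element of \<open>E\<close> orthogonal to
      itself.\<close>
    have "q - p v \<in> E" using that p sub by (simp add: subspace_diff)
    from p(2)[OF this, of v] that(2)[OF this] have "cinner (q - p v) ((v - p v) - (v - q)) = 0"
      unfolding cinner_def by (simp add: right_diff_distrib sum_subtractf)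
    then have "(q - p v) \<bullet> (q - p v) = 0" by (simp add: inner_eq_Re_cinner)
    then show ?thesis by simp
  qed
  have lin: "Vector_Spaces.linear (*s) (*s) p"
  proof
    fix v w c
    show "p (v + w) = p v + p w"
    proof (rule uniq[symmetric])
      show "p v + p w \<in> E" using p sub by (simp add: subspace_add)
      fix x assume "x \<in> E"
      from p(2)[OF this, of v] p(2)[OF this, of w]
      show "cinner x (v + w - (p v + p w)) = 0"
        unfolding cinner_def by (simp add: algebra_simps sum.distrib sum_subtractf)
    qed
    show "p (c *s v) = c *s p v"
    proof (rule uniq[symmetric])
      show "c *s p v \<in> E" using p cplx by simp
      fix x assume "x \<in> E"
      from p(2)[OF this, of v]
      show "cinner x (c *s v - c *s p v) = 0"
        unfolding vec.scale_right_diff_distrib[symmetric] cinner_scaleC_right by simp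
    qed
  qed
  have mp: "matrix p *v v = p v" for v
    by (rule matrix_works[OF lin])
  have p_id: "p v = v" if "v \<in> E" for v
    using uniq[OF that, of v] by (simp add: cinner_def)
  have cs: "cinner v w = cnj (cinner w v)" for v w :: "complex^'d"
    by (simp add: cinner_def mult.commute)
  have diff: "cinner v (w - w') = cinner v w - cinner v w'" for v w w' :: "complex^'d"
    by (simp add: cinner_def algebra_simps sum_subtractf)
  have herm: "hermitian (matrix p)"
  proof -
    have "cinner (p v) w = cinner v (p w)" for v w
    proof -
      have "cinner (p v) w = cinner (p v) (p w)"
        using p(2)[OF p(1), of v w] by (simp add: diff)
      also have "\<dots> = cinner v (p w)"
        using p(2)[OF p(1), of w v] cs[of "p w" "p v"] cs[of "p w" v] by (simp add: diff)
      finally show ?thesis .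
    qed
    then show ?thesis by (simp add: hermitian_iff_cinner mp)
  qed
  show ?thesis
  proof (rule ex1I[of _ "matrix p"], intro conjI)
    show "hermitian (matrix p)" by fact
    show "matrix p ** matrix p = matrix p"
      by (simp add: matrix_eq matrix_vector_mul_assoc[symmetric] mp p_id p)
    show "range ((*v) (matrix p)) = E"
    proof (intro equalityI subsetI)
      fix v assume "v \<in> E"
      then have "v = matrix p *v v" by (simp only: mp p_id)
      then show "v \<in> range ((*v) (matrix p))" by blast
    next
      fix v assume "v \<in> range ((*v) (matrix p))"
      then show "v \<in> E" using p(1) by (auto simp only: mp)
    qed
  next
    fix P assume P: "hermitian P \<and> P ** P = P \<and> range ((*v) P) = E"
    have "P *v v = p v" for v
    proof (rule uniq)
      show "P *v v \<in> E" using P by blast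
      fix w assume "w \<in> E"
      then obtain u where "w = P *v u" using P by blast
      then have "P *v w = w" using P by (simp add: matrix_vector_mul_assoc)
      then have "cinner w (P *v v) = cinner w v"
        using P cinner_matrix_hermitian[of P w v] by simp
      then show "cinner w (v - P *v v) = 0" by (simp add: diff)
    qed
    then show "P = matrix p" by (simp add: matrix_eq mp)
  qed
qed

lemma matrix_vector_mult_scaleC: "(A :: complex^'d^'d) *v (c *s v) = c *s (A *v v)"
  by (rule vec.scale)

lemma
  fixes A :: "complex^'d^'d"
  shows hermitian_spectral_proj: "hermitian (spectral_proj A l)"
    and spectral_proj_idem: "spectral_proj A l ** spectral_proj A l = spectral_proj A l"
    and range_spectral_proj: "range ((*v) (spectral_proj A l)) = eigenspace A l"
proof -
  have "\<exists>!P. hermitian P \<and> P ** P = P \<and> range ((*v) P) = eigenspace A l"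
  proof (rule complex_subspace_projection_ex1)
    show "subspace (eigenspace A l)"
      using matrix_vector_mul_linear[of A]
      by (auto simp: subspace_def eigenspace_def linear_add linear_scale scaleR_right_distrib)
    show "c *s v \<in> eigenspace A l" if "v \<in> eigenspace A l" for c v
      using that by (simp add: eigenspace_def matrix_vector_mult_scaleC vec_eq_iff)
  qed
  from theI'[OF this, folded spectral_proj_def]
  show "hermitian (spectral_proj A l)" "spectral_proj A l ** spectral_proj A l = spectral_proj A l"
    "range ((*v) (spectral_proj A l)) = eigenspace A l" by auto
qed

lemma spectral_proj_eigenvector:
  assumes A: "hermitian A" and v: "v \<in> eigenspace A m"
  shows "spectral_proj A l *v v = (if l = m then v else 0)"
proof (cases "l = m")
  case True
  then obtain u where "v = spectral_proj A l *v u"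
    using v range_spectral_proj by blast
  then show ?thesis
    using True by (simp add: matrix_vector_mul_assoc spectral_proj_idem)
next
  case False
  let ?P = "spectral_proj A l"
  have "?P *v v \<in> eigenspace A l"
    using range_spectral_proj by blast
  then have "v \<bullet> (?P *v v) = 0"
    using False A v by (intro eigenspace_orthogonal[of A v m]) auto
  moreover have "v \<bullet> (?P *v v) = (?P *v v) \<bullet> (?P *v v)"
    using inner_matrix_hermitian[OF hermitian_spectral_proj[of A l], of v "?P *v v"]
    by (simp add: matrix_vector_mul_assoc spectral_proj_idem)
  ultimately show ?thesis using False by simp
qed

text \<open>One chosen eigenvector per eigenvalue gives a pairwise orthogonal set, which is finite
  in finite dimension. This keeps the sum in \<open>matrix_fun\<close> from falling to the default
  value 0 of an infinite sum.\<close>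

lemma finite_eigenvalues:
  fixes A :: "complex^'d^'d"
  assumes A: "hermitian A"
  shows "finite (eigenvalues A)"
proof -
  define w where "w l = (SOME v. v \<in> eigenspace A l \<and> v \<noteq> 0)" for l
  have w: "w l \<in> eigenspace A l" "w l \<noteq> 0" if "l \<in> eigenvalues A" for l
    using that someI_ex[of "\<lambda>v. v \<in> eigenspace A l \<and> v \<noteq> 0"]
    unfolding w_def eigenvalues_def by auto
  have orth: "w l \<bullet> w m = 0" if "l \<in> eigenvalues A" "m \<in> eigenvalues A" "l \<noteq> m" for l m
    using that A w by (intro eigenspace_orthogonal) auto
  have "inj_on w (eigenvalues A)"
    using orth w(2) by (metis inj_onI inner_eq_zero_iff)
  moreover have "finite (w ` eigenvalues A)"
  proof (rule pairwise_orthogonal_imp_finite)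
    show "pairwise orthogonal (w ` eigenvalues A)"
      using orth by (fastforce simp: pairwise_def orthogonal_def)
  qed
  ultimately show ?thesis by (metis finite_imageD)
qed

lemma hermitian_zero: "hermitian 0"
  by (simp add: hermitian_def)

lemma hermitian_add: "hermitian A \<Longrightarrow> hermitian B \<Longrightarrow> hermitian (A + B)"
  unfolding hermitian_def vector_add_component complex_cnj_add by metis

lemma hermitian_scaleR: "hermitian A \<Longrightarrow> hermitian (c *\<^sub>R A)"
  unfolding hermitian_def vector_scaleR_component complex_cnj_scaleR by metis

lemma hermitian_sum: "(\<And>i. i \<in> I \<Longrightarrow> hermitian (A i)) \<Longrightarrow> hermitian (sum A I)"
  by (induction I rule: infinite_finite_induct) (auto intro: hermitian_zero hermitian_add)

lemma hermitian_matrix_fun: "hermitian (matrix_fun f A)"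
  unfolding matrix_fun_def by (intro hermitian_sum hermitian_scaleR hermitian_spectral_proj)

lemma scaleR_matrix_vector: "(c *\<^sub>R (A :: complex^'d^'d)) *v v = c *\<^sub>R (A *v v)"
  by (simp add: matrix_vector_mult_def vec_eq_iff scaleR_right.sum)

lemma matrix_fun_eigenvector:
  fixes A :: "complex^'d^'d"
  assumes A: "hermitian A" and v: "v \<in> eigenspace A m"
  shows "matrix_fun f A *v v = f m *\<^sub>R v"
proof (cases "v = 0")
  case False
  then have m: "m \<in> eigenvalues A" using v by (auto simp: eigenvalues_def)
  have sum_v: "(\<Sum>i\<in>I. M i) *v v = (\<Sum>i\<in>I. M i *v v)"
    for I :: "real set" and M :: "real \<Rightarrow> complex^'d^'d"
    by (induction I rule: infinite_finite_induct) (auto simp: matrix_vector_mult_add_rdistrib)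
  have "matrix_fun f A *v v = (\<Sum>l\<in>eigenvalues A. if l = m then f l *\<^sub>R v else 0)"
    unfolding matrix_fun_def sum_v scaleR_matrix_vector spectral_proj_eigenvector[OF A v]
    by (intro sum.cong) auto
  then show ?thesis using m finite_eigenvalues[OF A] by simp
qed simp

text \<open>The premise \<open>v \<noteq> 0\<close> lets the caller treat \<open>l\<close> as a
  genuine eigenvalue, so that bounds on the spectrum apply to it.\<close>

lemma matrix_fun_eqI:
  assumes "hermitian A" "\<And>l v. v \<in> eigenspace A l \<Longrightarrow> v \<noteq> 0 \<Longrightarrow> M *v v = f l *\<^sub>R v"
  shows "matrix_fun f A = M"
proof (rule matrix_eqI_eigenspaces[OF assms(1)])
  fix l v assume "v \<in> eigenspace A l"
  then show "matrix_fun f A *v v = M *v v"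
    using assms(2)[of v l] matrix_fun_eigenvector[OF assms(1), of v l f] by (cases "v = 0") auto
qed

section \<open>Matrix power series and their derivatives\<close>

text \<open>Termwise differentiation by a Weierstrass majorant: the tails of \<open>b\<close> bound
  the tails of the derivative series uniformly on \<open>S\<close>, relative to
  \<open>norm h\<close>.\<close>

lemma has_derivative_suminf:
  fixes f :: "nat \<Rightarrow> 'a::real_normed_vector \<Rightarrow> 'b::banach"
  assumes S: "convex S" "open S" "x \<in> S"
    and der: "\<And>n y. y \<in> S \<Longrightarrow> (f n has_derivative f' n y) (at y)"
    and bnd: "\<And>n y h. y \<in> S \<Longrightarrow> norm (f' n y h) \<le> b n * norm h"
    and b: "summable b"
    and f: "summable (\<lambda>n. f n x)"
  shows "((\<lambda>y. \<Sum>n. f n y) has_derivative (\<lambda>h. \<Sum>n. f' n x h)) (at x)"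
proof -
  have *: "\<forall>\<^sub>F n in sequentially. \<forall>y\<in>S. \<forall>h.
      norm ((\<Sum>i<n. f' i y h) - (\<Sum>i. f' i y h)) \<le> e * norm h" if "e > 0" for e
  proof -
    have "\<forall>\<^sub>F n in sequentially. norm (\<Sum>i. b (i + n)) < e"
      using suminf_exist_split[OF \<open>0 < e\<close> b] by (auto simp: eventually_sequentially)
    then show ?thesis
    proof eventually_elim
      fix n assume n: "norm (\<Sum>i. b (i + n)) < e"
      show "\<forall>y\<in>S. \<forall>h. norm ((\<Sum>i<n. f' i y h) - (\<Sum>i. f' i y h)) \<le> e * norm h"
      proof (intro ballI allI)
        fix y h :: 'a assume y: "y \<in> S"
        have bh: "summable (\<lambda>i. b i * norm h)"
          using b by (rule summable_mult2)
        have sm: "summable (\<lambda>i. f' i y h)"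
          by (rule summable_comparison_test'[OF bh]) (use bnd[OF y] in auto)
        have bn: "summable (\<lambda>i. b (i + n))"
          using b by (simp add: summable_iff_shift)
        have "norm ((\<Sum>i<n. f' i y h) - (\<Sum>i. f' i y h)) = norm (\<Sum>i. f' (i + n) y h)"
          using suminf_split_initial_segment[OF sm, of n] by (simp add: norm_minus_commute)
        also have "\<dots> \<le> (\<Sum>i. b (i + n) * norm h)"
          by (intro norm_suminf_le summable_mult2 bn bnd y)
        also have "\<dots> = (\<Sum>i. b (i + n)) * norm h"
          by (rule suminf_mult2[OF bn, symmetric])
        also have "\<dots> \<le> e * norm h"
          using n by (intro mult_right_mono) auto
        finally show "norm ((\<Sum>i<n. f' i y h) - (\<Sum>i. f' i y h)) \<le> e * norm h" .
      qed
    qed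
  qed
  have "\<exists>g. \<forall>y\<in>S. (\<lambda>n. f n y) sums g y \<and> (g has_derivative (\<lambda>h. \<Sum>n. f' n y h)) (at y within S)"
    using S(1) has_derivative_at_withinI[OF der] * S(3) summable_sums[OF f]
    by (rule has_derivative_series)
  then obtain g where g: "\<And>y. y \<in> S \<Longrightarrow> (\<lambda>n. f n y) sums g y"
    "\<And>y. y \<in> S \<Longrightarrow> (g has_derivative (\<lambda>h. \<Sum>n. f' n y h)) (at y within S)" by blast
  have "(g has_derivative (\<lambda>h. \<Sum>n. f' n x h)) (at x)"
    using g(2)[OF S(3)] at_within_open[OF S(3,2)] by simp
  then show ?thesis
    by (rule has_derivative_transform_within_open[OF _ S(2,3)]) (use g(1) sums_unique in blast)
qed

section \<open>Matrix products and the operator norm\<close>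

lemma bounded_bilinear_matrix_mult:
  "bounded_bilinear (\<lambda>(A :: complex^'n^'m) (B :: complex^'k^'n). A ** B)"
  unfolding bilinear_conv_bounded_bilinear[symmetric] bilinear_def
  by (auto intro!: linearI simp: matrix_matrix_mult_def vec_eq_iff sum.distrib algebra_simps scaleR_sum_right)

lemma bounded_bilinear_matrix_vector_mult:
  "bounded_bilinear (\<lambda>(A :: complex^'n^'m) v. A *v v)"
  unfolding bilinear_conv_bounded_bilinear[symmetric] bilinear_def
  by (auto intro!: linearI simp: matrix_vector_mult_def vec_eq_iff sum.distrib algebra_simps scaleR_sum_right)

text \<open>The ambient \<open>norm\<close> on matrices is the entrywise Euclidean one, and
  derivatives are taken in it. Powers are estimated in the operator norm, where the identity has
  norm at most 1 and the radius of convergence is read off directly.\<close>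

abbreviation opnorm :: "complex^'d^'d \<Rightarrow> real" where
  "opnorm A \<equiv> onorm ((*v) A)"

lemma norm_matrix_vector_le_opnorm: "norm ((A :: complex^'d^'d) *v v) \<le> opnorm A * norm v"
  by (rule onorm) simp

lemma opnorm_nonneg: "0 \<le> opnorm A"
  by (rule onorm_pos_le) simp

lemma opnorm_mult: "opnorm (A ** B) \<le> opnorm A * opnorm B"
proof -
  have "(*v) (A ** B) = (*v) A \<circ> (*v) B"
    by (simp add: fun_eq_iff matrix_vector_mul_assoc)
  then show ?thesis
    using onorm_compose[of "(*v) A" "(*v) B"] by simp
qed

lemma opnorm_add: "opnorm (A + B) \<le> opnorm A + opnorm B"
proof -
  have "(*v) (A + B) = (\<lambda>v. A *v v + B *v v)"
    by (simp add: fun_eq_iff matrix_vector_mult_add_rdistrib)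
  then show ?thesis
    using onorm_triangle[of "(*v) A" "(*v) B"] by simp
qed

lemma opnorm_mat_1: "opnorm (mat 1 :: complex^'d^'d) \<le> 1"
  by (rule onorm_le) simp

text \<open>One direction is boundedness of the bilinear action. For the other, every entry
  satisfies \<open>norm (A $ i $ j) \<le> norm (A *v axis j 1) \<le> opnorm A\<close>, and
  \<open>D\<close> counts the entries.\<close>

lemma opnorm_equivalent_norm:
  "\<exists>K>0. (\<forall>A :: complex^'d^'d. opnorm A \<le> K * norm A) \<and>
     (\<forall>A :: complex^'d^'d. norm A \<le> K * opnorm A)"
proof -
  interpret bounded_bilinear "\<lambda>(A :: complex^'d^'d) v. A *v v"
    by (rule bounded_bilinear_matrix_vector_mult)
  obtain K where K: "K > 0" "\<And>(A :: complex^'d^'d) v. norm (A *v v) \<le> norm A * norm v * K"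
    using pos_bounded by blast
  define D where "D = (real CARD('d))\<^sup>2"
  have "norm A \<le> D * opnorm A" for A :: "complex^'d^'d"
  proof -
    have ij: "norm (A $ i $ j) \<le> opnorm A" for i j
    proof -
      have "norm (A $ i $ j) \<le> norm (A *v axis j 1)"
        using Finite_Cartesian_Product.norm_nth_le[of "A *v axis j 1" i]
        by (simp add: matrix_vector_mult_axis)
      also have "\<dots> \<le> opnorm A"
        using norm_matrix_vector_le_opnorm[of A "axis j 1"] by simp
      finally show ?thesis .
    qed
    have "norm A \<le> (\<Sum>i\<in>UNIV. norm (A $ i))"
      unfolding norm_vec_def[of A] by (rule L2_set_le_sum) simp
    also have "\<dots> \<le> (\<Sum>i\<in>UNIV. \<Sum>j\<in>UNIV. norm (A $ i $ j))"
      unfolding norm_vec_def[of "A $ _"] by (intro sum_mono L2_set_le_sum) simp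
    also have "\<dots> \<le> (\<Sum>i\<in>(UNIV::'d set). \<Sum>j\<in>(UNIV::'d set). opnorm A)"
      by (intro sum_mono ij)
    also have "\<dots> = D * opnorm A" by (simp add: D_def power2_eq_square)
    finally show ?thesis .
  qed
  moreover have "opnorm A \<le> K * norm A" for A :: "complex^'d^'d"
    using K by (intro onorm_le) (simp add: mult_ac)
  moreover have "K * norm A \<le> max K D * norm A" "D * opnorm A \<le> max K D * opnorm A" for A :: "complex^'d^'d"
    by (auto intro!: mult_right_mono opnorm_nonneg)
  ultimately have "opnorm A \<le> max K D * norm A \<and> norm A \<le> max K D * opnorm A" for A :: "complex^'d^'d"
    by (meson order_trans)
  then show ?thesis
    using \<open>K > 0\<close> by (intro exI[of _ "max K D"]) simp
qed

section \<open>Matrix powers and their first two derivatives\<close>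

primrec mpow :: "complex^'d^'d \<Rightarrow> nat \<Rightarrow> complex^'d^'d" where
  "mpow X 0 = mat 1"
| "mpow X (Suc n) = mpow X n ** X"

text \<open>\<open>mpow_d1 X Y n\<close> is the derivative of \<open>X\<^sup>n\<close> in direction \<open>Y\<close>, and \<open>mpow_d2 X Y Z n\<close> that of
  \<open>mpow_d1 X Y n\<close> in direction \<open>Z\<close> of \<open>X\<close>; the recursions are the product rule.\<close>

primrec mpow_d1 :: "complex^'d^'d \<Rightarrow> complex^'d^'d \<Rightarrow> nat \<Rightarrow> complex^'d^'d" where
  "mpow_d1 X Y 0 = 0"
| "mpow_d1 X Y (Suc n) = mpow_d1 X Y n ** X + mpow X n ** Y"

primrec mpow_d2 ::
    "complex^'d^'d \<Rightarrow> complex^'d^'d \<Rightarrow> complex^'d^'d \<Rightarrow> nat \<Rightarrow> complex^'d^'d" where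
  "mpow_d2 X Y Z 0 = 0"
| "mpow_d2 X Y Z (Suc n) = mpow_d2 X Y Z n ** X + mpow_d1 X Y n ** Z + mpow_d1 X Z n ** Y"

lemma has_derivative_mpow:
  "((\<lambda>X. mpow X n) has_derivative (\<lambda>Y. mpow_d1 X Y n)) (at X)"
proof (induction n)
  case (Suc n)
  show ?case
    using bounded_bilinear.FDERIV[OF bounded_bilinear_matrix_mult Suc has_derivative_ident]
    by (simp add: add.commute)
qed simp

text \<open>Differentiates jointly in base point and direction, because along a curve of matrices
  both vary. Since \<open>mpow_d1\<close> is linear in its direction, the direction increment enters
  as \<open>mpow_d1 X (snd h) n\<close>.\<close>

lemma has_derivative_mpow_d1:
  "((\<lambda>p. mpow_d1 (fst p) (snd p) n) has_derivative
     (\<lambda>h. mpow_d2 X Y (fst h) n + mpow_d1 X (snd h) n)) (at (X, Y))"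
proof (induction n)
  case (Suc n)
  have "((\<lambda>p. mpow (fst p) n) has_derivative (\<lambda>h. mpow_d1 X (fst h) n)) (at (X, Y))"
    by (rule has_derivative_compose[OF has_derivative_fst[OF has_derivative_ident]])
      (simp add: has_derivative_mpow)
  from bounded_bilinear.FDERIV[OF bounded_bilinear_matrix_mult this
      has_derivative_snd[OF has_derivative_ident]]
  have *: "((\<lambda>p. mpow (fst p) n ** snd p) has_derivative
      (\<lambda>h. mpow X n ** snd h + mpow_d1 X (fst h) n ** Y)) (at (X, Y))" by simp
  from bounded_bilinear.FDERIV[OF bounded_bilinear_matrix_mult Suc
      has_derivative_fst[OF has_derivative_ident]]
  have "((\<lambda>p. mpow_d1 (fst p) (snd p) n ** fst p) has_derivative
      (\<lambda>h. mpow_d1 X Y n ** fst h + (mpow_d2 X Y (fst h) n + mpow_d1 X (snd h) n) ** X)) (at (X, Y))"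
    by simp
  from has_derivative_add[OF this *] show ?case
    unfolding mpow_d1.simps mpow_d2.simps
    by (rule has_derivative_eq_rhs)
      (simp add: bounded_bilinear.add_left[OF bounded_bilinear_matrix_mult] add_ac)
qed simp

section \<open>Power bounds in terms of any \<open>r\<close> above the operator norm, hence uniform
  on balls\<close>

context
  fixes X :: "complex^'d^'d" and r :: real
  assumes X: "opnorm X \<le> r"
begin

lemma opnorm_bound_nonneg: "0 \<le> r"
  using X opnorm_nonneg[of X] by linarith

lemma opnorm_mpow_le: "opnorm (mpow X n) \<le> r ^ n"
proof (induction n)
  case (Suc n)
  have "opnorm (mpow X (Suc n)) \<le> opnorm (mpow X n) * opnorm X"
    using opnorm_mult by simp
  also have "\<dots> \<le> r ^ n * r"
    using Suc X by (intro mult_mono) (auto simp: opnorm_nonneg opnorm_bound_nonneg)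
  finally show ?case by (simp add: mult.commute)
qed (simp only: mpow.simps power_0 opnorm_mat_1)

text \<open>Each of the n terms of the product rule carries n - 1 factors \<open>X\<close>. The
  truncated exponent at n = 0 is harmless because of the factor n.\<close>

lemma opnorm_mpow_d1_le: "opnorm (mpow_d1 X Y n) \<le> n * r ^ (n - 1) * opnorm Y"
proof (induction n)
  case (Suc n)
  have "opnorm (mpow_d1 X Y (Suc n)) \<le> opnorm (mpow_d1 X Y n) * opnorm X + opnorm (mpow X n) * opnorm Y"
    using opnorm_add[of "mpow_d1 X Y n ** X" "mpow X n ** Y"]
      opnorm_mult[of "mpow_d1 X Y n" X] opnorm_mult[of "mpow X n" Y] by simp
  also have "\<dots> \<le> (n * r ^ (n - 1) * opnorm Y) * r + r ^ n * opnorm Y"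
    using Suc X by (intro add_mono mult_mono mult_right_mono opnorm_mpow_le)
      (auto simp: opnorm_nonneg opnorm_bound_nonneg)
  also have "\<dots> = Suc n * r ^ (Suc n - 1) * opnorm Y"
    by (cases n) (auto simp: algebra_simps)
  finally show ?case .
qed (simp add: onorm_zero)

text \<open>There are n (n - 1) ordered placements of the two directions. The factor
  \<open>real n - 1\<close> is real while the exponent \<open>n - 2\<close> is truncated; for n = 0
  and n = 1 the product vanishes, so both conventions agree.\<close>

lemma opnorm_mpow_d2_le:
  "opnorm (mpow_d2 X Y Z n) \<le> n * (real n - 1) * r ^ (n - 2) * (opnorm Y * opnorm Z)"
proof (induction n)
  case (Suc n)
  let ?y = "opnorm Y" and ?z = "opnorm Z"
  have "opnorm (mpow_d2 X Y Z (Suc n))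
      \<le> opnorm (mpow_d2 X Y Z n) * opnorm X + opnorm (mpow_d1 X Y n) * ?z + opnorm (mpow_d1 X Z n) * ?y"
    using opnorm_add[of "mpow_d2 X Y Z n ** X + mpow_d1 X Y n ** Z" "mpow_d1 X Z n ** Y"]
      opnorm_add[of "mpow_d2 X Y Z n ** X" "mpow_d1 X Y n ** Z"]
      opnorm_mult[of "mpow_d2 X Y Z n" X] opnorm_mult[of "mpow_d1 X Y n" Z]
      opnorm_mult[of "mpow_d1 X Z n" Y] by simp
  also have "\<dots> \<le> (n * (real n - 1) * r ^ (n - 2) * (?y * ?z)) * r
      + (n * r ^ (n - 1) * ?y) * ?z + (n * r ^ (n - 1) * ?z) * ?y"
  proof (intro add_mono mult_mono mult_right_mono opnorm_mpow_d1_le Suc X opnorm_nonneg)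
    show "0 \<le> real n * (real n - 1) * r ^ (n - 2) * (?y * ?z)"
      by (cases n) (auto simp: opnorm_nonneg opnorm_bound_nonneg)
  qed (simp_all add: opnorm_nonneg opnorm_bound_nonneg)
  also have "\<dots> = Suc n * (real (Suc n) - 1) * r ^ (Suc n - 2) * (?y * ?z)"
  proof -
    consider "n = 0" | "n = 1" | k where "n = Suc (Suc k)"
      by (metis One_nat_def not0_implies_Suc)
    then show ?thesis by cases (auto simp: algebra_simps)
  qed
  finally show ?case .
qed (simp add: onorm_zero)

end


text \<open>A majorant for termwise differentiation must hold on a whole neighbourhood; the midpoint
  between \<open>opnorm X\<close> and \<open>R\<close> is a common radius still below
  \<open>R\<close>.\<close>

lemma opnorm_bound_near:
  fixes X :: "complex^'d^'d"
  assumes "opnorm X < R"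
  shows "\<exists>d>0. \<forall>X'. dist X X' < d \<longrightarrow> opnorm X' \<le> (opnorm X + R) / 2"
proof -
  obtain K where K: "K > 0" "\<And>A :: complex^'d^'d. opnorm A \<le> K * norm A"
      "\<And>A :: complex^'d^'d. norm A \<le> K * opnorm A"
    using opnorm_equivalent_norm by metis
  define d where "d = (R - opnorm X) / (2 * K)"
  show ?thesis
  proof (intro exI[of _ d] conjI allI impI)
    show "d > 0" using assms K by (simp add: d_def)
    fix X' assume "dist X X' < d"
    then have "K * norm (X' - X) \<le> K * d"
      using K by (simp add: dist_norm norm_minus_commute)
    also have "K * d = (R - opnorm X) / 2" using K by (simp add: d_def)
    finally show "opnorm X' \<le> (opnorm X + R) / 2"
      using opnorm_add[of X "X' - X"] K(2)[of "X' - X"] by (simp add: field_simps)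
  qed
qed

section \<open>Matrix power series inside the radius of convergence\<close>

definition mseries :: "(nat \<Rightarrow> real) \<Rightarrow> complex^'d^'d \<Rightarrow> complex^'d^'d" where
  "mseries a X = (\<Sum>n. a n *\<^sub>R mpow X n)"

text \<open>The Frechet derivative of \<open>mseries a\<close> at \<open>X\<close> in direction
  \<open>Y\<close>, kept as a series because \<open>X\<close> and \<open>Y\<close> need not
  commute.\<close>

definition mseries_d :: "(nat \<Rightarrow> real) \<Rightarrow> complex^'d^'d \<Rightarrow> complex^'d^'d \<Rightarrow> complex^'d^'d" where
  "mseries_d a X Y = (\<Sum>n. a n *\<^sub>R mpow_d1 X Y n)"

context
  fixes a :: "nat \<Rightarrow> real" and R :: real
  assumes conv: "\<And>x. \<bar>x\<bar> < R \<Longrightarrow> summable (\<lambda>n. \<bar>a n\<bar> * x ^ n)"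
begin

lemma summable_coeff_d1:
  fixes r :: real
  assumes "0 \<le> r" "r < R"
  shows "summable (\<lambda>n. \<bar>a n\<bar> * (real n * r ^ (n - 1)))"
proof -
  have "summable (\<lambda>n. diffs (\<lambda>n. \<bar>a n\<bar>) n * r ^ n)"
    using assms by (intro termdiff_converges[of r R] conv) auto
  then have "summable (\<lambda>n. \<bar>a (Suc n)\<bar> * (Suc n * r ^ (Suc n - 1)))"
    by (simp add: diffs_def mult_ac)
  then show ?thesis by (rule summable_Suc_iff[THEN iffD1])
qed

text \<open>Scalar termwise differentiation applied twice; \<open>diffs\<close> indexes by the
  exponent after differentiation, which causes the shift by 2.\<close>

lemma summable_coeff_d2:
  fixes r :: real
  assumes "0 \<le> r" "r < R"
  shows "summable (\<lambda>n. \<bar>a n\<bar> * (real n * (real n - 1) * r ^ (n - 2)))"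
proof -
  have "summable (\<lambda>n. diffs (\<lambda>n. \<bar>a n\<bar>) n * x ^ n)" if "norm x < R" for x
    using that by (intro termdiff_converges[of x R] conv) auto
  then have "summable (\<lambda>n. diffs (diffs (\<lambda>n. \<bar>a n\<bar>)) n * r ^ n)"
    using assms by (intro termdiff_converges[of r R]) auto
  then have "summable (\<lambda>n. \<bar>a (n + 2)\<bar> * ((n + 2) * (real (n + 2) - 1) * r ^ (n + 2 - 2)))"
    by (simp add: diffs_def mult_ac add_ac)
  then show ?thesis by (rule summable_iff_shift[THEN iffD1])
qed

lemma summable_mseries:
  fixes X :: "complex^'d^'d"
  assumes "opnorm X < R"
  shows "summable (\<lambda>n. a n *\<^sub>R mpow X n)"
proof -
  obtain K where K: "K > 0" "\<And>A :: complex^'d^'d. opnorm A \<le> K * norm A"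
      "\<And>A :: complex^'d^'d. norm A \<le> K * opnorm A"
    using opnorm_equivalent_norm by metis
  have "summable (\<lambda>n. K * (\<bar>a n\<bar> * opnorm X ^ n))"
    using assms opnorm_nonneg[of X] by (intro summable_mult conv) simp
  then show ?thesis
  proof (rule summable_comparison_test')
    fix n
    have "norm (a n *\<^sub>R mpow X n) \<le> \<bar>a n\<bar> * (K * opnorm X ^ n)"
      using K(1) opnorm_mpow_le[of X "opnorm X" n]
      by (auto intro!: mult_left_mono order_trans[OF K(3)])
    then show "norm (a n *\<^sub>R mpow X n) \<le> K * (\<bar>a n\<bar> * opnorm X ^ n)" by (simp add: mult_ac)
  qed
qed

text \<open>One factor \<open>K\<close> turns the norm of the value into \<open>opnorm\<close>, the
  other turns \<open>opnorm Y\<close> back into \<open>norm Y\<close>.\<close>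

lemma norm_mseries_d_term:
  fixes X :: "complex^'d^'d"
  assumes K: "K > 0" "\<And>A :: complex^'d^'d. opnorm A \<le> K * norm A"
      "\<And>A :: complex^'d^'d. norm A \<le> K * opnorm A"
    and r: "opnorm X \<le> r"
  shows "norm (a n *\<^sub>R mpow_d1 X Y n) \<le> (\<bar>a n\<bar> * (real n * r ^ (n - 1))) * (K * K) * norm Y"
proof -
  have r0: "0 \<le> r" using r opnorm_nonneg[of X] by simp
  have "norm (mpow_d1 X Y n) \<le> K * opnorm (mpow_d1 X Y n)" by (rule K)
  also have "\<dots> \<le> K * (real n * r ^ (n - 1) * (K * norm Y))"
    using K r0 by (intro mult_left_mono order_trans[OF opnorm_mpow_d1_le[OF r]]) auto
  finally show ?thesis
    using mult_left_mono[of "norm (mpow_d1 X Y n)" _ "\<bar>a n\<bar>"] by (fastforce simp: mult_ac)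
qed

lemma summable_mseries_d:
  fixes X :: "complex^'d^'d"
  assumes "opnorm X < R"
  shows "summable (\<lambda>n. a n *\<^sub>R mpow_d1 X Y n)"
proof -
  obtain K where K: "K > 0" "\<And>A :: complex^'d^'d. opnorm A \<le> K * norm A"
      "\<And>A :: complex^'d^'d. norm A \<le> K * opnorm A"
    using opnorm_equivalent_norm by metis
  have "summable (\<lambda>n. (\<bar>a n\<bar> * (real n * opnorm X ^ (n - 1))) * (K * K) * norm Y)"
    using assms opnorm_nonneg[of X] by (intro summable_mult2 summable_coeff_d1) auto
  then show ?thesis
    by (rule summable_comparison_test') (rule norm_mseries_d_term[OF K order_refl])
qed

lemma has_derivative_mseries:
  fixes X :: "complex^'d^'d"
  assumes X: "opnorm X < R"
  shows "(mseries a has_derivative mseries_d a X) (at X)"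
proof -
  obtain K where K: "K > 0" "\<And>A :: complex^'d^'d. opnorm A \<le> K * norm A"
      "\<And>A :: complex^'d^'d. norm A \<le> K * opnorm A"
    using opnorm_equivalent_norm by metis
  obtain d where d: "d > 0" "\<And>X'. dist X X' < d \<Longrightarrow> opnorm X' \<le> (opnorm X + R) / 2"
    using opnorm_bound_near[OF X] by metis
  show ?thesis
    unfolding mseries_def[abs_def] mseries_d_def[abs_def]
  proof (rule has_derivative_suminf)
    show "convex (ball X d)" "open (ball X d)" "X \<in> ball X d" using d by auto
    show "((\<lambda>X. a n *\<^sub>R mpow X n) has_derivative (\<lambda>Y. a n *\<^sub>R mpow_d1 X' Y n)) (at X')" for n X'
      by (intro has_derivative_scaleR_right has_derivative_mpow)
    show "norm (a n *\<^sub>R mpow_d1 X' Y n)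
        \<le> (\<bar>a n\<bar> * (real n * ((opnorm X + R) / 2) ^ (n - 1))) * (K * K) * norm Y"
      if "X' \<in> ball X d" for n X' Y
      using that d by (intro norm_mseries_d_term K) auto
    show "summable (\<lambda>n. (\<bar>a n\<bar> * (real n * ((opnorm X + R) / 2) ^ (n - 1))) * (K * K))"
      using X opnorm_nonneg[of X] by (intro summable_mult2 summable_coeff_d1) auto
  qed (rule summable_mseries[OF X])
qed

text \<open>Supplies the second derivative of the series: with both arguments varying, the chain
  rule can be applied to first derivatives along a family.\<close>

lemma differentiable_mseries_d:
  fixes X Y :: "complex^'d^'d"
  assumes X: "opnorm X < R"
  shows "(\<lambda>p. mseries_d a (fst p) (snd p)) differentiable (at (X, Y))"
proof -
  obtain K where K: "K > 0" "\<And>A :: complex^'d^'d. opnorm A \<le> K * norm A"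
      "\<And>A :: complex^'d^'d. norm A \<le> K * opnorm A"
    using opnorm_equivalent_norm by metis
  obtain d where d: "d > 0" "\<And>X'. dist X X' < d \<Longrightarrow> opnorm X' \<le> (opnorm X + R) / 2"
    using opnorm_bound_near[OF X] by metis
  define r where "r = (opnorm X + R) / 2"
  have r: "0 \<le> r" "r < R" using X opnorm_nonneg[of X] by (auto simp: r_def)
  \<comment> \<open>Bounds the direction component on the ball, whose radius is therefore capped by
    1.\<close>
  define M where "M = norm Y + 1"
  \<comment> \<open>The first summand majorizes the change of base point, with \<open>K * M\<close>
    bounding the current direction; the second majorizes the change of direction.\<close>
  define b where "b n = (\<bar>a n\<bar> * (real n * (real n - 1) * r ^ (n - 2))) * (K * (K * M) * K)
      + (\<bar>a n\<bar> * (real n * r ^ (n - 1))) * (K * K)" for n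
  define D where "D n p h = a n *\<^sub>R (mpow_d2 (fst p) (snd p) (fst h) n + mpow_d1 (fst p) (snd h) n)"
    for n and p h :: "(complex^'d^'d) \<times> (complex^'d^'d)"
  have "((\<lambda>p. \<Sum>n. a n *\<^sub>R mpow_d1 (fst p) (snd p) n) has_derivative (\<lambda>h. \<Sum>n. D n (X, Y) h)) (at (X, Y))"
  proof (rule has_derivative_suminf)
    show "convex (ball (X, Y) (min d 1))" "open (ball (X, Y) (min d 1))"
      "(X, Y) \<in> ball (X, Y) (min d 1)" using d by auto
    show "((\<lambda>p. a n *\<^sub>R mpow_d1 (fst p) (snd p) n) has_derivative D n p) (at p)" for n p
      unfolding D_def using has_derivative_mpow_d1[of n "fst p" "snd p"]
      by (intro has_derivative_scaleR_right) simp
    show "summable b"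
      unfolding b_def using r by (intro summable_add summable_mult2 summable_coeff_d1 summable_coeff_d2)
    show "summable (\<lambda>n. a n *\<^sub>R mpow_d1 (fst (X, Y)) (snd (X, Y)) n)"
      using summable_mseries_d[OF X] by simp
    show "norm (D n p h) \<le> b n * norm h" if p: "p \<in> ball (X, Y) (min d 1)" for n p h
    proof -
      obtain X' Y' where p_eq: "p = (X', Y')" by fastforce
      obtain U V where h: "h = (U, V)" by fastforce
      have X': "opnorm X' \<le> r"
        using p d(2)[of X'] dist_fst_le[of "(X, Y)" p] by (auto simp: r_def p_eq)
      have "norm Y' \<le> M"
        using p dist_snd_le[of "(X, Y)" p] norm_triangle_ineq2[of Y' Y]
        by (auto simp: M_def p_eq dist_norm norm_minus_commute)
      then have Y': "opnorm Y' \<le> K * M"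
        using K(1) by (intro order_trans[OF K(2)] mult_left_mono) auto
      have KM: "0 \<le> K * M" using K(1) by (simp add: M_def)
      have U: "norm U \<le> norm h" and V: "norm V \<le> norm h"
        unfolding h by (rule norm_fst_le, rule norm_snd_le)
      have nn: "0 \<le> real n * (real n - 1) * r ^ (n - 2)"
        using r by (cases n) auto
      have "norm (mpow_d2 X' Y' U n) \<le> K * opnorm (mpow_d2 X' Y' U n)" by (rule K)
      also have "\<dots> \<le> K * (real n * (real n - 1) * r ^ (n - 2) * ((K * M) * (K * norm h)))"
      proof (intro mult_left_mono order_trans[OF opnorm_mpow_d2_le[OF X']] mult_mono Y' KM nn opnorm_nonneg)
        show "opnorm U \<le> K * norm h"
          using K(1) U by (intro order_trans[OF K(2)] mult_left_mono) auto
      qed (use K(1) in auto)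
      finally have "norm (a n *\<^sub>R mpow_d2 X' Y' U n)
          \<le> \<bar>a n\<bar> * (K * (real n * (real n - 1) * r ^ (n - 2) * ((K * M) * (K * norm h))))"
        by (simp add: mult_left_mono)
      moreover have "norm (a n *\<^sub>R mpow_d1 X' V n) \<le> (\<bar>a n\<bar> * (real n * r ^ (n - 1))) * (K * K) * norm h"
        using r K(1) V by (intro order_trans[OF norm_mseries_d_term[OF K X']] mult_left_mono) auto
      moreover have "norm (D n p h) \<le> norm (a n *\<^sub>R mpow_d2 X' Y' U n) + norm (a n *\<^sub>R mpow_d1 X' V n)"
        unfolding D_def p_eq h by (simp add: scaleR_add_right norm_triangle_ineq del: norm_scaleR)
      ultimately show ?thesis
        by (simp add: b_def algebra_simps)
    qed
  qed
  then show ?thesis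
    unfolding mseries_d_def differentiable_def by blast
qed

end

section \<open>Exponential and logarithm\<close>

lemma mpow_eigenvector:
  fixes X :: "complex^'d^'d"
  assumes "X *v v = l *\<^sub>R v"
  shows "mpow X n *v v = l ^ n *\<^sub>R v"
proof (induction n)
  case (Suc n)
  have "mpow X (Suc n) *v v = mpow X n *v (l *\<^sub>R v)"
    by (simp add: matrix_vector_mul_assoc[symmetric] assms)
  also have "\<dots> = l *\<^sub>R (mpow X n *v v)"
    by (rule linear_scale) simp
  finally show ?case by (simp add: Suc)
qed simp

text \<open>Evaluation at \<open>v\<close> is continuous and linear in the matrix, so on an
  eigenvector the matrix series becomes the scalar series at its eigenvalue.\<close>

lemma mseries_eigenvector:
  fixes X :: "complex^'d^'d"
  assumes conv: "\<And>x. \<bar>x\<bar> < R \<Longrightarrow> summable (\<lambda>n. \<bar>a n\<bar> * x ^ n)" and X: "opnorm X < R"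
    and v: "X *v v = l *\<^sub>R v" and s: "(\<lambda>n. a n * l ^ n) sums s"
  shows "mseries a X *v v = s *\<^sub>R v"
proof -
  have "(\<lambda>n. a n *\<^sub>R mpow X n) sums mseries a X"
    unfolding mseries_def using summable_mseries[OF conv X] by (rule summable_sums)
  then have "(\<lambda>n. (a n *\<^sub>R mpow X n) *v v) sums (mseries a X *v v)"
    by (rule bounded_linear.sums[OF bounded_bilinear.bounded_linear_left
          [OF bounded_bilinear_matrix_vector_mult]])
  moreover have "(a n *\<^sub>R mpow X n) *v v = (a n * l ^ n) *\<^sub>R v" for n
    by (simp add: scaleR_matrix_vector mpow_eigenvector[OF v])
  ultimately have "(\<lambda>n. (a n * l ^ n) *\<^sub>R v) sums (mseries a X *v v)"
    by simp
  moreover have "(\<lambda>n. (a n * l ^ n) *\<^sub>R v) sums (s *\<^sub>R v)"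
    using s by (rule sums_scaleR_left)
  ultimately show ?thesis by (rule sums_unique2)
qed

lemma mpow_add: "mpow X (m + n) = mpow X m ** mpow X n"
  by (induction n) (auto simp: matrix_mul_assoc)

text \<open>Cyclicity of the trace merges the n terms of the product rule. The extra factor
  \<open>mpow X m\<close> is what the induction needs: it absorbs the trailing
  \<open>X\<close>.\<close>

lemma trace_mpow_d1:
  "trace (mpow_d1 X Y n ** mpow X m) = of_nat n * trace (mpow X (n - 1 + m) ** Y)"
proof (induction n arbitrary: m)
  case (Suc n)
  have "X ** mpow X m = mpow X (Suc m)"
    using mpow_add[of X 1 m] by simp
  then have "mpow_d1 X Y n ** X ** mpow X m = mpow_d1 X Y n ** mpow X (Suc m)"
    by (metis matrix_mul_assoc)
  moreover have "trace (mpow X n ** Y ** mpow X m) = trace (mpow X (n + m) ** Y)"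
    by (metis add.commute matrix_mul_assoc mpow_add trace_mul_sym)
  moreover have "of_nat n * trace (mpow X (n - 1 + Suc m) ** Y) = of_nat n * trace (mpow X (n + m) ** Y)"
    by (cases n) auto
  ultimately show ?case
    using Suc[of "Suc m"]
    by (simp add: bounded_bilinear.add_left[OF bounded_bilinear_matrix_mult] trace_add
        distrib_right del: mpow.simps)
qed (simp add: trace_def bounded_bilinear.zero_left[OF bounded_bilinear_matrix_mult])

lemma bounded_linear_Re_trace: "bounded_linear (\<lambda>A :: complex^'d^'d. Re (trace A))"
  unfolding linear_conv_bounded_linear[symmetric]
  by (auto intro!: linearI simp: trace_def sum.distrib scaleR_sum_right sum_distrib_left)

lemma Re_trace_scaleR: "Re (trace (c *\<^sub>R A)) = c * Re (trace A)"
  by (rule linear_scale[OF bounded_linear.linear[OF bounded_linear_Re_trace], unfolded real_scaleR_def])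

section \<open>The exponential series\<close>

definition exp_coeff :: "nat \<Rightarrow> real" where "exp_coeff n = inverse (fact n)"

lemma exp_coeff_sums: "(\<lambda>n. exp_coeff n * x ^ n) sums exp x"
  using exp_converges[of x] by (simp add: exp_coeff_def)

lemma exp_coeff_summable: "summable (\<lambda>n. \<bar>exp_coeff n\<bar> * x ^ n)"
  using exp_coeff_sums[of x] by (simp add: exp_coeff_def sums_iff)

lemma matrix_exp_eigenvector:
  fixes X :: "complex^'d^'d"
  assumes "X *v v = l *\<^sub>R v"
  shows "mseries exp_coeff X *v v = exp l *\<^sub>R v"
  \<comment> \<open>The coefficients are summable at every radius, so any \<open>R\<close> above
    \<open>opnorm X\<close> serves.\<close>
  by (rule mseries_eigenvector[where R = "opnorm X + 1"])
    (use assms exp_coeff_sums exp_coeff_summable in auto)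

lemma matrix_exp_eq_mseries:
  fixes X :: "complex^'d^'d"
  assumes "hermitian X"
  shows "matrix_exp X = mseries exp_coeff X"
  by (rule matrix_fun_eqI[OF assms]) (simp add: eigenspace_def matrix_exp_eigenvector)

lemma has_derivative_mseries_exp:
  fixes X :: "complex^'d^'d"
  shows "(mseries exp_coeff has_derivative mseries_d exp_coeff X) (at X)"
  by (rule has_derivative_mseries[where R = "opnorm X + 1"]) (auto intro: exp_coeff_summable)

text \<open>Under the trace the derivative of exp looks commutative: the n + 1 from
  \<open>trace_mpow_d1\<close> cancels against (n + 1)! and leaves the exponential coefficient of
  index n.\<close>

lemma Re_trace_mseries_d_exp:
  fixes X :: "complex^'d^'d"
  shows "Re (trace (mseries_d exp_coeff X Y)) = Re (trace (mseries exp_coeff X ** Y))"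
proof -
  have "(\<lambda>n. exp_coeff n *\<^sub>R mpow X n) sums mseries exp_coeff X"
    unfolding mseries_def
    by (rule summable_sums, rule summable_mseries[where R = "opnorm X + 1"])
      (auto intro: exp_coeff_summable)
  then have "(\<lambda>n. Re (trace ((exp_coeff n *\<^sub>R mpow X n) ** Y))) sums Re (trace (mseries exp_coeff X ** Y))"
    by (intro bounded_linear.sums[OF bounded_linear_Re_trace]
        bounded_linear.sums[OF bounded_bilinear.bounded_linear_left[OF bounded_bilinear_matrix_mult]])
  moreover have "Re (trace ((exp_coeff n *\<^sub>R mpow X n) ** Y))
      = Re (trace (exp_coeff (Suc n) *\<^sub>R mpow_d1 X Y (Suc n)))" for n
  proof -
    have "trace (mpow_d1 X Y (Suc n)) = of_nat (Suc n) * trace (mpow X n ** Y)"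
      using trace_mpow_d1[of X Y "Suc n" 0] by simp
    then have "Re (trace (exp_coeff (Suc n) *\<^sub>R mpow_d1 X Y (Suc n)))
        = exp_coeff (Suc n) * (real (Suc n) * Re (trace (mpow X n ** Y)))"
      by (simp add: Re_trace_scaleR del: mpow_d1.simps of_nat_Suc)
    also have "\<dots> = exp_coeff n * Re (trace (mpow X n ** Y))"
      by (simp add: exp_coeff_def field_simps del: of_nat_Suc)
    also have "\<dots> = Re (trace ((exp_coeff n *\<^sub>R mpow X n) ** Y))"
      by (simp add: Re_trace_scaleR bounded_bilinear.scaleR_left[OF bounded_bilinear_matrix_mult])
    finally show ?thesis by simp
  qed
  ultimately have "(\<lambda>n. Re (trace (exp_coeff (Suc n) *\<^sub>R mpow_d1 X Y (Suc n))))
      sums Re (trace (mseries exp_coeff X ** Y))" by (simp only:)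
  \<comment> \<open>Undoing the index shift adds only the term n = 0, which is zero.\<close>
  then have "(\<lambda>n. Re (trace (exp_coeff n *\<^sub>R mpow_d1 X Y n))) sums Re (trace (mseries exp_coeff X ** Y))"
    using sums_Suc[of "\<lambda>n. Re (trace (exp_coeff n *\<^sub>R mpow_d1 X Y n))"]
    by (fastforce simp: trace_def)
  moreover have "(\<lambda>n. exp_coeff n *\<^sub>R mpow_d1 X Y n) sums mseries_d exp_coeff X Y"
    unfolding mseries_d_def
    by (rule summable_sums, rule summable_mseries_d[where R = "opnorm X + 1"])
      (auto intro: exp_coeff_summable)
  then have "(\<lambda>n. Re (trace (exp_coeff n *\<^sub>R mpow_d1 X Y n))) sums Re (trace (mseries_d exp_coeff X Y))"
    by (rule bounded_linear.sums[OF bounded_linear_Re_trace])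
  ultimately show ?thesis using sums_unique2 by blast
qed

section \<open>The series of ln (1 + x) and the logarithm of positive definite matrices\<close>

definition ln_coeff :: "nat \<Rightarrow> real" where
  "ln_coeff n = (if n = 0 then 0 else (-1) ^ (n - 1) / n)"

lemma ln_coeff_summable: "\<bar>x\<bar> < 1 \<Longrightarrow> summable (\<lambda>n. \<bar>ln_coeff n\<bar> * x ^ n)"
proof (rule summable_comparison_test')
  assume "\<bar>x\<bar> < 1"
  then show "summable (\<lambda>n. \<bar>x\<bar> ^ n)" by (simp add: summable_geometric)
  have "\<bar>ln_coeff n\<bar> \<le> 1" for n
    by (simp add: ln_coeff_def power_abs abs_mult)
  then show "norm (\<bar>ln_coeff n\<bar> * x ^ n) \<le> \<bar>x\<bar> ^ n" for n
    by (simp add: abs_mult power_abs mult_left_le_one_le)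
qed

lemma ln_coeff_sums:
  assumes x: "\<bar>x\<bar> < 1"
  shows "(\<lambda>n. ln_coeff n * x ^ n) sums ln (1 + x)"
proof -
  have "summable (\<lambda>n. ln_coeff n * x ^ n)"
  proof (rule summable_comparison_test')
    show "summable (\<lambda>n. \<bar>ln_coeff n\<bar> * \<bar>x\<bar> ^ n)" using x by (intro ln_coeff_summable) simp
  qed (simp add: abs_mult power_abs)
  then have "summable (\<lambda>n. ln_coeff (Suc n) * x ^ Suc n)"
    by (rule summable_Suc_iff[THEN iffD2])
  moreover have "(\<Sum>n. ln_coeff (Suc n) * x ^ Suc n) = ln (1 + x)"
    using ln_series[of "1 + x"] x by (simp add: ln_coeff_def)
  ultimately have "(\<lambda>n. ln_coeff (Suc n) * x ^ Suc n) sums ln (1 + x)"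
    by (metis summable_sums)
  from sums_Suc[OF this] show ?thesis by (simp add: ln_coeff_def)
qed

text \<open>The quadratic form attains a positive minimum on the compact unit sphere; homogeneity
  extends the bound to all vectors.\<close>

lemma pos_def_lower_bound:
  fixes A :: "complex^'d^'d"
  assumes "pos_def A"
  obtains m where "m > 0" "\<And>v. m * (v \<bullet> v) \<le> v \<bullet> (A *v v)"
proof -
  have pos: "0 < v \<bullet> (A *v v)" if "v \<noteq> 0" for v
    using assms that by (simp add: pos_def_def inner_eq_Re_cinner)
  have "continuous_on (sphere 0 1) (\<lambda>v. v \<bullet> (A *v v))"
    by (intro continuous_intros)
  moreover have "sphere (0 :: complex^'d) 1 \<noteq> {}" by (simp add: sphere_eq_empty)
  ultimately obtain u where u: "norm u = 1"
    "\<And>v. norm v = 1 \<Longrightarrow> u \<bullet> (A *v u) \<le> v \<bullet> (A *v v)"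
    using continuous_attains_inf[of "sphere 0 1" "\<lambda>v. v \<bullet> (A *v v)"] by auto
  show thesis
  proof (rule that)
    show "0 < u \<bullet> (A *v u)" using u by (intro pos) auto
    fix v
    show "u \<bullet> (A *v u) * (v \<bullet> v) \<le> v \<bullet> (A *v v)"
    proof (cases "v = 0")
      case False
      then have "u \<bullet> (A *v u) \<le> (v /\<^sub>R norm v) \<bullet> (A *v (v /\<^sub>R norm v))"
        by (intro u(2)) simp
      also have "\<dots> = (v \<bullet> (A *v v)) / (norm v)\<^sup>2"
        using linear_scale[OF matrix_vector_mul_linear[of A]]
        by (simp add: power2_eq_square field_simps)
      finally show ?thesis
        using False by (simp add: le_divide_eq power2_norm_eq_inner)
    qed simp
  qed
qed

text \<open>Expanding the square of \<open>norm ((A /\<^sub>R c - mat 1) *v v)\<close>, the cross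
  term gains \<open>2 * m / c\<close> by positivity, while the quadratic term costs at most
  \<open>m / c\<close> once \<open>c\<close> is large.\<close>

lemma pos_def_rescale:
  fixes A :: "complex^'d^'d"
  assumes "pos_def A"
  obtains c where "c > 0" "opnorm (A /\<^sub>R c - mat 1) < 1"
proof -
  obtain m where m: "m > 0" "\<And>v. m * (v \<bullet> v) \<le> v \<bullet> (A *v v)"
    using pos_def_lower_bound[OF assms] by metis
  define N where "N = opnorm A"
  have N: "0 \<le> N" unfolding N_def by (rule opnorm_nonneg)
  \<comment> \<open>The first summand yields \<open>N\<^sup>2 \<le> m * c\<close>, the second
    \<open>m \<le> c\<close>, which keeps \<open>1 - m / c\<close> nonnegative under the
    root.\<close>
  define c where "c = N\<^sup>2 / m + m"
  have c: "c > 0" using m N by (simp add: c_def add_nonneg_pos)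
  have "N\<^sup>2 \<le> m * c" using m by (simp add: c_def algebra_simps)
  have mc: "m \<le> c" using m by (simp add: c_def)
  have "norm ((A /\<^sub>R c - mat 1) *v v) \<le> sqrt (1 - m / c) * norm v" for v
  proof -
    have "(A /\<^sub>R c - mat 1) *v v = (A *v v) /\<^sub>R c - v"
      by (simp add: matrix_vector_mult_diff_rdistrib scaleR_matrix_vector)
    moreover have "(norm (w /\<^sub>R c - v))\<^sup>2 = (norm w)\<^sup>2 / c\<^sup>2 - 2 / c * (v \<bullet> w) + (norm v)\<^sup>2" for w
      by (simp add: power2_norm_eq_inner inner_diff_left inner_diff_right inner_commute[of w v]
          power2_eq_square[of c] divide_inverse algebra_simps)
    ultimately have "(norm ((A /\<^sub>R c - mat 1) *v v))\<^sup>2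
        = (norm (A *v v))\<^sup>2 / c\<^sup>2 - 2 / c * (v \<bullet> (A *v v)) + (norm v)\<^sup>2"
      by simp
    also have "\<dots> \<le> (N * norm v)\<^sup>2 / c\<^sup>2 - 2 / c * (m * (norm v)\<^sup>2) + (norm v)\<^sup>2"
      using m(2)[of v] c norm_matrix_vector_le_opnorm[of A v]
      by (intro add_mono diff_mono divide_right_mono mult_left_mono power_mono)
        (auto simp: N_def power2_norm_eq_inner)
    also have "\<dots> = (N\<^sup>2 / c\<^sup>2 - 2 * m / c + 1) * (norm v)\<^sup>2"
      by (simp add: algebra_simps power_mult_distrib)
    also have "\<dots> \<le> (1 - m / c) * (norm v)\<^sup>2"
    proof (rule mult_right_mono)
      have "N\<^sup>2 / c\<^sup>2 \<le> m * c / c\<^sup>2" using \<open>N\<^sup>2 \<le> m * c\<close> by (intro divide_right_mono) auto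
      also have "\<dots> = m / c" by (simp add: power2_eq_square)
      finally show "N\<^sup>2 / c\<^sup>2 - 2 * m / c + 1 \<le> 1 - m / c" by simp
    qed simp
    also have "\<dots> = (sqrt (1 - m / c) * norm v)\<^sup>2"
      using c mc by (simp add: power_mult_distrib)
    finally show ?thesis
      by (rule power2_le_imp_le) (use c mc in simp)
  qed
  then have "opnorm (A /\<^sub>R c - mat 1) \<le> sqrt (1 - m / c)" by (rule onorm_le)
  also have "\<dots> < 1" using m c mc by simp
  finally show thesis using c that by blast
qed

text \<open>On an eigenvector the shifted matrix acts as \<open>l / c - 1\<close>, of modulus below
  1 by the norm bound. This gives \<open>l > 0\<close> and ln c + ln (1 + (l / c - 1)) = ln
  l.\<close>

lemma matrix_ln_eq_mseries:
  fixes A :: "complex^'d^'d"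
  assumes A: "hermitian A" and c: "c > 0" and n: "opnorm (A /\<^sub>R c - mat 1) < 1"
  shows "matrix_ln A = ln c *\<^sub>R mat 1 + mseries ln_coeff (A /\<^sub>R c - mat 1)"
proof (rule matrix_fun_eqI[OF A])
  fix l v assume "v \<in> eigenspace A l" "v \<noteq> 0"
  then have v: "(A /\<^sub>R c - mat 1) *v v = (l / c - 1) *\<^sub>R v"
    by (simp add: eigenspace_def matrix_vector_mult_diff_rdistrib scaleR_matrix_vector
        scaleR_left_diff_distrib divide_inverse mult.commute)
  have "\<bar>l / c - 1\<bar> * norm v \<le> opnorm (A /\<^sub>R c - mat 1) * norm v"
    using norm_matrix_vector_le_opnorm[of "A /\<^sub>R c - mat 1" v] by (simp add: v)
  then have lc: "\<bar>l / c - 1\<bar> < 1" using \<open>v \<noteq> 0\<close> n by simp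
  have "mseries ln_coeff (A /\<^sub>R c - mat 1) *v v = ln (1 + (l / c - 1)) *\<^sub>R v"
    using ln_coeff_summable n v ln_coeff_sums[OF lc] by (rule mseries_eigenvector)
  moreover have "l / c > 0" using lc by simp
  then have "l > 0" using c by (simp add: zero_less_divide_iff)
  ultimately show "(ln c *\<^sub>R mat 1 + mseries ln_coeff (A /\<^sub>R c - mat 1)) *v v = ln l *\<^sub>R v"
    using c by (simp add: matrix_vector_mult_add_rdistrib scaleR_matrix_vector ln_div
        scaleR_add_left[symmetric])
qed

lemma pos_def_eigenvalue_pos:
  assumes "pos_def A" "v \<in> eigenspace A l" "v \<noteq> 0"
  shows "l > 0"
proof -
  have "0 < v \<bullet> (A *v v)" using assms by (simp add: pos_def_def inner_eq_Re_cinner)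
  then have "0 < l * (v \<bullet> v)" using assms by (simp add: eigenspace_def)
  moreover have "0 < v \<bullet> v" using assms by simp
  ultimately show ?thesis by (rule zero_less_mult_pos2)
qed

lemma matrix_exp_matrix_ln:
  fixes A :: "complex^'d^'d"
  assumes "pos_def A"
  shows "mseries exp_coeff (matrix_ln A) = A"
proof -
  have A: "hermitian A" using assms by (simp add: pos_def_def)
  show ?thesis
  proof (rule matrix_eqI_eigenspaces[OF A])
    fix l v assume v: "v \<in> eigenspace A l"
    show "mseries exp_coeff (matrix_ln A) *v v = A *v v"
    proof (cases "v = 0")
      case False
      have "mseries exp_coeff (matrix_ln A) *v v = exp (ln l) *\<^sub>R v"
        by (rule matrix_exp_eigenvector) (rule matrix_fun_eigenvector[OF A v])
      then show ?thesis
        using pos_def_eigenvalue_pos[OF assms v False] v by (simp add: eigenspace_def)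
    qed simp
  qed
qed

section \<open>Derivatives along a normalized family\<close>

text \<open>Near \<open>x\<close> the logarithm is one fixed power series composed with a rescaling
  of \<open>g\<close>. The chain rule gives the first derivative, and joint differentiability of
  \<open>mseries_d\<close> gives the second.\<close>

lemma twice_differentiable_matrix_ln:
  fixes g :: "'a::real_normed_vector \<Rightarrow> complex^'d^'d"
  assumes g: "twice_differentiable g" and pd: "\<And>x. pos_def (g x)"
  defines "K \<equiv> \<lambda>x. matrix_ln (g x)"
  shows "K differentiable (at x)"
    and "(\<lambda>y. frechet_derivative K (at y) u) differentiable (at x)"
proof -
  obtain g' where g': "\<And>y. (g has_derivative blinfun_apply (g' y)) (at y)"
    "\<And>y. g' differentiable (at y)"
    using g unfolding twice_differentiable_def by blast
  obtain c where c: "c > 0" "opnorm (g x /\<^sub>R c - mat 1) < 1"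
    using pos_def_rescale[OF pd[of x]] by metis
  define h where "h y = g y /\<^sub>R c - mat 1" for y
  have h: "(h has_derivative (\<lambda>v. g' y v /\<^sub>R c)) (at y)" for y
    unfolding h_def
    using has_derivative_diff[OF has_derivative_scaleR_right[OF g'(1)[of y]] has_derivative_const] by simp
  obtain d where d: "d > 0" "\<And>X. dist (h x) X < d \<Longrightarrow> opnorm X \<le> (opnorm (h x) + 1) / 2"
    using opnorm_bound_near[of "h x" 1] c by (auto simp: h_def)
  \<comment> \<open>An open neighbourhood on which the constant \<open>c\<close> chosen at
    \<open>x\<close> keeps the series convergent.\<close>
  define U where "U = {y. dist (h x) (h y) < d}"
  have "continuous_on UNIV h"
    using h by (meson continuous_at_imp_continuous_on has_derivative_continuous)
  then have U: "open U" "x \<in> U"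
    unfolding U_def using d(1) by (auto intro!: open_Collect_less continuous_intros)
  have op: "opnorm (h y) < 1" if "y \<in> U" for y
    using d(2)[of "h y"] that c by (simp add: U_def h_def)
  have K_eq: "K y = ln c *\<^sub>R mat 1 + mseries ln_coeff (h y)" if "y \<in> U" for y
    unfolding K_def h_def using pd[of y] c(1) op[OF that]
    by (intro matrix_ln_eq_mseries) (auto simp: pos_def_def h_def)
  have dK: "(K has_derivative (\<lambda>v. mseries_d ln_coeff (h y) (g' y v /\<^sub>R c))) (at y)" if y: "y \<in> U" for y
  proof (rule has_derivative_transform_within_open)
    show "((\<lambda>y. ln c *\<^sub>R mat 1 + mseries ln_coeff (h y)) has_derivative
        (\<lambda>v. mseries_d ln_coeff (h y) (g' y v /\<^sub>R c))) (at y)"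
      using has_derivative_add[OF has_derivative_const
          has_derivative_compose[OF h has_derivative_mseries[OF ln_coeff_summable op[OF y]]]] by simp
  qed (use U y K_eq in auto)
  show "K differentiable (at x)"
    using dK[OF U(2)] by (auto simp: differentiable_def)
  have "(\<lambda>y. g' y u) differentiable (at x)"
    using g'(2)[of x] bounded_linear.has_derivative[OF blinfun.bounded_linear_left]
    unfolding differentiable_def by blast
  then obtain G where "((\<lambda>y. g' y u) has_derivative G) (at x)"
    unfolding differentiable_def by blast
  then have "((\<lambda>y. (h y, g' y u /\<^sub>R c)) has_derivative (\<lambda>v. (g' x v /\<^sub>R c, G v /\<^sub>R c))) (at x)"
    by (intro has_derivative_Pair h has_derivative_scaleR_right)
  moreover obtain M where
    "((\<lambda>p. mseries_d ln_coeff (fst p) (snd p)) has_derivative M) (at (h x, g' x u /\<^sub>R c))"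
    using differentiable_mseries_d[OF ln_coeff_summable op[OF U(2)]] unfolding differentiable_def by blast
  ultimately obtain D where
    "((\<lambda>y. mseries_d ln_coeff (h y) (g' y u /\<^sub>R c)) has_derivative D) (at x)"
    using has_derivative_compose by fastforce
  then have "((\<lambda>y. frechet_derivative K (at y) u) has_derivative D) (at x)"
    by (rule has_derivative_transform_within_open[OF _ U]) (simp flip: frechet_derivative_at[OF dK])
  then show "(\<lambda>y. frechet_derivative K (at y) u) differentiable (at x)"
    unfolding differentiable_def by blast
qed

section \<open>Derivatives along lines in parameter space\<close>

lemma has_vector_derivative_line:
  assumes "f differentiable (at x)"
  shows "((\<lambda>t. f (x + t *\<^sub>R u)) has_vector_derivative frechet_derivative f (at x) u) (at 0)"
proof -
  have f: "(f has_derivative frechet_derivative f (at x)) (at (x + 0 *\<^sub>R u))"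
    using assms by (simp add: frechet_derivative_works)
  have "((\<lambda>t. x + t *\<^sub>R u) has_derivative (\<lambda>t. t *\<^sub>R u)) (at 0)"
    by (auto intro!: derivative_eq_intros)
  from has_derivative_compose[OF this f] show ?thesis
    using linear_scale[OF has_derivative_linear[OF f]]
    by (simp add: has_vector_derivative_def)
qed

lemma has_real_derivative_Re_trace:
  "(F has_vector_derivative F') (at t) \<Longrightarrow>
    ((\<lambda>t. Re (trace (F t))) has_real_derivative Re (trace F')) (at t)"
  unfolding has_real_derivative_iff_has_vector_derivative
  by (rule bounded_linear.has_vector_derivative[OF bounded_linear_Re_trace])

text \<open>A Frechet derivative is linear in its direction.\<close>

lemma mseries_d_exp_scaleR:
  "mseries_d exp_coeff X (c *\<^sub>R Y) = c *\<^sub>R mseries_d exp_coeff X Y"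
  by (rule linear_scale[OF has_derivative_linear[OF has_derivative_mseries_exp]])

lemma has_vector_derivative_mseries_exp:
  assumes "(F has_vector_derivative F') (at t)"
  shows "((\<lambda>t. mseries exp_coeff (F t)) has_vector_derivative mseries_d exp_coeff (F t) F') (at t)"
  using has_derivative_compose[OF assms[unfolded has_vector_derivative_def] has_derivative_mseries_exp]
  by (simp add: has_vector_derivative_def mseries_d_exp_scaleR)

lemma has_vector_derivative_matrix_mult:
  fixes F G :: "real \<Rightarrow> complex^'d^'d"
  assumes "(F has_vector_derivative F') (at t)" "(G has_vector_derivative G') (at t)"
  shows "((\<lambda>t. F t ** G t) has_vector_derivative (F t ** G' + F' ** G t)) (at t)"
  using assms by (rule bounded_bilinear.has_vector_derivative[OF bounded_bilinear_matrix_mult])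

lemma partial_deriv_eqI:
  assumes "((\<lambda>t. F (x + t *\<^sub>R axis i 1)) has_real_derivative D) (at 0)"
  shows "partial_deriv i F x = D"
  unfolding partial_deriv_def using assms by (rule DERIV_imp_deriv)

text \<open>Replaces the states by their logarithm \<open>K\<close>. Differentiating the identity
  \<open>normalized\<close> once and twice yields all cancellations below.\<close>

locale normalized_log_family =
  fixes K :: "real^'l \<Rightarrow> complex^'d^'d" and \<theta> :: "real^'l"
  assumes normalized: "\<And>x. Re (trace (mseries exp_coeff (K x))) = 1"
    and K1: "\<And>x. K differentiable (at x)"
    and K2: "\<And>x u. (\<lambda>y. frechet_derivative K (at y) u) differentiable (at x)"
begin

text \<open>At \<open>s = 1\<close> this is the family \<open>K\<close> itself; at
  \<open>s = 1 - \<alpha>\<close> it is the exponent in the Renyi entropy.\<close>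

definition log_path :: "real \<Rightarrow> real^'l \<Rightarrow> complex^'d^'d" where
  "log_path s x = K \<theta> + s *\<^sub>R (K x - K \<theta>)"

definition dK :: "real^'l \<Rightarrow> real^'l \<Rightarrow> complex^'d^'d" where
  "dK u x = frechet_derivative K (at x) u"

definition partition_fun :: "real \<Rightarrow> real^'l \<Rightarrow> real" where
  "partition_fun s x = Re (trace (mseries exp_coeff (log_path s x)))"

text \<open>Expectation of \<open>dK u x\<close> in the unnormalized Gibbs operator; division by
  \<open>partition_fun\<close> happens only in the derivative of its logarithm.\<close>

definition gibbs_mean :: "real \<Rightarrow> real^'l \<Rightarrow> real^'l \<Rightarrow> real" where
  "gibbs_mean s u x = Re (trace (mseries exp_coeff (log_path s x) ** dK u x))"

text \<open>The Bogoliubov-Kubo-Mori form of two logarithmic derivatives, called Q in the opening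
  idea.\<close>

definition bkm :: "real^'l \<Rightarrow> real^'l \<Rightarrow> real" where
  "bkm w u = Re (trace (mseries_d exp_coeff (K \<theta>) (dK w \<theta>) ** dK u \<theta>))"

lemma K_line: "((\<lambda>t. K (x + t *\<^sub>R u)) has_vector_derivative dK u x) (at 0)"
  unfolding dK_def by (rule has_vector_derivative_line[OF K1])

lemma log_path_line: "((\<lambda>t. log_path s (x + t *\<^sub>R u)) has_vector_derivative s *\<^sub>R dK u x) (at 0)"
  unfolding log_path_def
  by (rule has_vector_derivative_eq_rhs) (auto intro!: derivative_eq_intros K_line)

lemma partition_fun_line:
  "((\<lambda>t. partition_fun s (x + t *\<^sub>R u)) has_real_derivative s * gibbs_mean s u x) (at 0)"
proof -
  have "Re (trace (mseries_d exp_coeff (log_path s x) (s *\<^sub>R dK u x))) = s * gibbs_mean s u x"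
    by (simp add: Re_trace_mseries_d_exp gibbs_mean_def Re_trace_scaleR
        bounded_bilinear.scaleR_right[OF bounded_bilinear_matrix_mult])
  then show ?thesis
    using has_real_derivative_Re_trace[OF has_vector_derivative_mseries_exp[OF log_path_line[of s x u]]]
    by (simp add: partition_fun_def)
qed

lemma partition_fun_one: "partition_fun 1 x = 1"
  by (simp add: partition_fun_def log_path_def normalized)

lemma log_path_base: "log_path s \<theta> = K \<theta>"
  by (simp add: log_path_def)

lemma partition_fun_base: "partition_fun s \<theta> = 1"
  by (simp add: partition_fun_def log_path_base normalized)

lemma gibbs_mean_one: "gibbs_mean 1 u x = 0"
proof -
  have "((\<lambda>t. 1 :: real) has_real_derivative gibbs_mean 1 u x) (at 0)"
    using partition_fun_line[of 1 x u] by (simp add: partition_fun_one)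
  then show ?thesis by (metis DERIV_const DERIV_unique)
qed

text \<open>At \<open>\<theta>\<close> the paths for all \<open>s\<close> meet, so the vanishing at
  \<open>s = 1\<close> carries over.\<close>

lemma gibbs_mean_base: "gibbs_mean s u \<theta> = 0"
  using gibbs_mean_one[of u \<theta>] by (simp add: gibbs_mean_def log_path_base)

lemma dK_line:
  "((\<lambda>t. dK u (x + t *\<^sub>R w)) has_vector_derivative frechet_derivative (dK u) (at x) w) (at 0)"
  unfolding dK_def[abs_def] by (rule has_vector_derivative_line[OF K2])

text \<open>Product rule: varying the exponential contributes the factor \<open>s\<close>, varying
  \<open>dK\<close> a term independent of \<open>s\<close>.\<close>

lemma gibbs_mean_line:
  "((\<lambda>t. gibbs_mean s u (\<theta> + t *\<^sub>R w)) has_real_derivative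
     s * bkm w u + Re (trace (mseries exp_coeff (K \<theta>) ** frechet_derivative (dK u) (at \<theta>) w))) (at 0)"
  using has_real_derivative_Re_trace[OF has_vector_derivative_matrix_mult
      [OF has_vector_derivative_mseries_exp[OF log_path_line[of s \<theta> w]] dK_line[of u \<theta> w]]]
  by (simp add: gibbs_mean_def bkm_def log_path_base trace_add Re_trace_scaleR add.commute
      mseries_d_exp_scaleR bounded_bilinear.scaleR_left[OF bounded_bilinear_matrix_mult])

text \<open>At \<open>s = 1\<close> the mean vanishes identically, hence so does its derivative. The
  term thus found does not involve \<open>s\<close> and can be reused for every
  \<open>s\<close>.\<close>

lemma Re_trace_second_derivative:
  "Re (trace (mseries exp_coeff (K \<theta>) ** frechet_derivative (dK u) (at \<theta>) w)) = - bkm w u"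
proof -
  have "((\<lambda>t. 0 :: real) has_real_derivative
      1 * bkm w u + Re (trace (mseries exp_coeff (K \<theta>) ** frechet_derivative (dK u) (at \<theta>) w))) (at 0)"
    using gibbs_mean_line[of 1 u w] by (simp add: gibbs_mean_one)
  then have "1 * bkm w u + Re (trace (mseries exp_coeff (K \<theta>) ** frechet_derivative (dK u) (at \<theta>) w)) = 0"
    by (metis DERIV_const DERIV_unique)
  then show ?thesis by simp
qed

lemma partial_deriv_cross_entropy:
  "partial_deriv i (partial_deriv j (\<lambda>\<epsilon>. Re (trace (mseries exp_coeff (K \<theta>) ** (K \<theta> - K (\<theta> + \<epsilon>)))))) 0
     = bkm (axis i 1) (axis j 1)"
proof -
  let ?u = "axis j 1 :: real^'l" and ?w = "axis i 1 :: real^'l" and ?P = "mseries exp_coeff (K \<theta>)"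
  have 1: "partial_deriv j (\<lambda>\<epsilon>. Re (trace (?P ** (K \<theta> - K (\<theta> + \<epsilon>))))) \<epsilon>
      = - Re (trace (?P ** dK ?u (\<theta> + \<epsilon>)))" for \<epsilon>
  proof (rule partial_deriv_eqI)
    have "((\<lambda>t. K \<theta> - K (\<theta> + \<epsilon> + t *\<^sub>R ?u)) has_vector_derivative 0 - dK ?u (\<theta> + \<epsilon>)) (at 0)"
      by (intro has_vector_derivative_diff has_vector_derivative_const K_line)
    from has_real_derivative_Re_trace[OF has_vector_derivative_matrix_mult
        [OF has_vector_derivative_const[of ?P] this]]
    show "((\<lambda>t. Re (trace (?P ** (K \<theta> - K (\<theta> + (\<epsilon> + t *\<^sub>R ?u))))))
        has_real_derivative - Re (trace (?P ** dK ?u (\<theta> + \<epsilon>)))) (at 0)"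
      by (simp add: add.assoc trace_add trace_def sum_negf
          bounded_bilinear.zero_left[OF bounded_bilinear_matrix_mult]
          bounded_bilinear.minus_right[OF bounded_bilinear_matrix_mult])
  qed
  show ?thesis
    unfolding 1
  proof (rule partial_deriv_eqI)
    have "((\<lambda>t. Re (trace (?P ** dK ?u (\<theta> + t *\<^sub>R ?w)))) has_real_derivative - bkm ?w ?u) (at 0)"
      using has_real_derivative_Re_trace[OF has_vector_derivative_matrix_mult
          [OF has_vector_derivative_const[of ?P] dK_line[of ?u \<theta> ?w]]]
      by (simp add: Re_trace_second_derivative bounded_bilinear.zero_left[OF bounded_bilinear_matrix_mult])
    from DERIV_minus[OF this]
    show "((\<lambda>t. - Re (trace (?P ** dK ?u (\<theta> + (0 + t *\<^sub>R ?w))))) has_real_derivative bkm ?w ?u) (at 0)"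
      by simp
  qed
qed

text \<open>The quotient rule simplifies at \<open>\<theta>\<close>, where
  \<open>partition_fun\<close> has value 1 and derivative 0; the mean has derivative
  \<open>(s - 1) * bkm\<close>.\<close>

lemma partial_deriv_ln_partition_fun:
  "partial_deriv i (partial_deriv j (\<lambda>\<epsilon>. k * ln (partition_fun s (\<theta> + \<epsilon>)))) 0
     = k * (s * (s - 1)) * bkm (axis i 1) (axis j 1)"
proof -
  let ?u = "axis j 1 :: real^'l" and ?w = "axis i 1 :: real^'l"
  have 1: "partial_deriv j (\<lambda>\<epsilon>. k * ln (partition_fun s (\<theta> + \<epsilon>))) \<epsilon>
      = k * (s * gibbs_mean s ?u (\<theta> + \<epsilon>) / partition_fun s (\<theta> + \<epsilon>))"
    if pos: "partition_fun s (\<theta> + \<epsilon>) > 0" for \<epsilon>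
  proof (rule partial_deriv_eqI)
    have "((\<lambda>t. ln (partition_fun s ((\<theta> + \<epsilon>) + t *\<^sub>R ?u))) has_real_derivative
        s * gibbs_mean s ?u (\<theta> + \<epsilon>) / partition_fun s (\<theta> + \<epsilon>)) (at 0)"
      using DERIV_chain2[OF DERIV_ln_divide partition_fun_line[of s "\<theta> + \<epsilon>" ?u]] pos by simp
    from DERIV_cmult[OF this, of k]
    show "((\<lambda>t. k * ln (partition_fun s (\<theta> + (\<epsilon> + t *\<^sub>R ?u)))) has_real_derivative
        k * (s * gibbs_mean s ?u (\<theta> + \<epsilon>) / partition_fun s (\<theta> + \<epsilon>))) (at 0)"
      by (simp add: add.assoc)
  qed
  have Z: "((\<lambda>t. partition_fun s (\<theta> + t *\<^sub>R ?w)) has_real_derivative 0) (at 0)"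
    using partition_fun_line[of s \<theta> ?w] by (simp add: gibbs_mean_base)
  \<comment> \<open>The formula for the first derivative requires a positive argument of ln.
    Continuity gives this near t = 0, and the outer derivative depends only on nearby
    values.\<close>
  have "\<forall>\<^sub>F t in at 0. partition_fun s (\<theta> + t *\<^sub>R ?w) > 0"
    by (rule order_tendstoD(1)[OF DERIV_isCont[OF Z, unfolded isCont_def]])
      (simp add: partition_fun_base)
  then have "\<forall>\<^sub>F t in nhds 0. partition_fun s (\<theta> + t *\<^sub>R ?w) > 0"
    by (simp add: eventually_nhds_conv_at partition_fun_base)
  then have ev: "\<forall>\<^sub>F t in nhds 0.
      partial_deriv j (\<lambda>\<epsilon>. k * ln (partition_fun s (\<theta> + \<epsilon>))) (0 + t *\<^sub>R ?w)
      = k * (s * gibbs_mean s ?u (\<theta> + t *\<^sub>R ?w) / partition_fun s (\<theta> + t *\<^sub>R ?w))"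
    by eventually_elim (simp add: 1)
  show ?thesis
  proof (rule partial_deriv_eqI, subst DERIV_cong_ev[OF refl ev refl])
    have "((\<lambda>t. gibbs_mean s ?u (\<theta> + t *\<^sub>R ?w)) has_real_derivative (s - 1) * bkm ?w ?u) (at 0)"
      using gibbs_mean_line[of s ?u ?w] by (simp add: Re_trace_second_derivative left_diff_distrib)
    from DERIV_divide[OF this Z]
    have "((\<lambda>t. gibbs_mean s ?u (\<theta> + t *\<^sub>R ?w) / partition_fun s (\<theta> + t *\<^sub>R ?w))
        has_real_derivative (s - 1) * bkm ?w ?u) (at 0)"
      by (simp add: partition_fun_base)
    from DERIV_cmult[OF this, of "k * s"]
    show "((\<lambda>t. k * (s * gibbs_mean s ?u (\<theta> + t *\<^sub>R ?w) / partition_fun s (\<theta> + t *\<^sub>R ?w)))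
        has_real_derivative k * (s * (s - 1)) * bkm ?w ?u) (at 0)"
      by (simp add: mult_ac)
  qed
qed

end

section \<open>Comparison of the two Hessians\<close>

theorem theorem3:
  fixes \<rho> :: "real^'l \<Rightarrow> complex^'d^'d"
    and \<alpha> :: real
    and \<theta> :: "real^'l"
  assumes "\<And>\<theta>. state (\<rho> \<theta>)"
    and "\<And>\<theta>. pos_def (\<rho> \<theta>)"
    and "twice_differentiable \<rho>"
    and "\<alpha> \<in> {0<..<1} \<union> {1<..}"
  shows "log_euclidean_info \<alpha> \<rho> \<theta> = kubo_mori_info \<rho> \<theta>"
proof -
  define K where "K x = matrix_ln (\<rho> x)" for x
  have herm: "hermitian (K x)" for x
    unfolding K_def by (rule hermitian_matrix_fun)
  have exp_K: "mseries exp_coeff (K x) = \<rho> x" for x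
    unfolding K_def using assms(2) by (rule matrix_exp_matrix_ln)
  have normalized: "Re (trace (mseries exp_coeff (K x))) = 1" for x
    using assms(1) by (simp add: exp_K state_def)
  have K1: "K differentiable (at x)" for x
    using twice_differentiable_matrix_ln(1)[OF assms(3,2)] by (simp add: K_def[abs_def])
  have K2: "(\<lambda>y. frechet_derivative K (at y) u) differentiable (at x)" for x u
    using twice_differentiable_matrix_ln(2)[OF assms(3,2)] by (simp add: K_def[abs_def])
  interpret normalized_log_family K \<theta>
    by unfold_locales (fact normalized K1 K2)+
  have renyi: "log_euclidean_renyi \<alpha> (\<rho> \<theta>) (\<rho> x)
      = 1 / (\<alpha> - 1) * ln (partition_fun (1 - \<alpha>) x)" for x
  proof -
    have "\<alpha> *\<^sub>R K \<theta> + (1 - \<alpha>) *\<^sub>R K x = log_path (1 - \<alpha>) x"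
      by (simp add: log_path_def algebra_simps)
    \<comment> \<open>Hermiticity allows the spectrally defined \<open>matrix_exp\<close> to be
      replaced by its power series.\<close>
    moreover have "hermitian (\<alpha> *\<^sub>R K \<theta> + (1 - \<alpha>) *\<^sub>R K x)"
      by (intro hermitian_add hermitian_scaleR herm)
    ultimately show ?thesis
      by (simp add: log_euclidean_renyi_def matrix_exp_eq_mseries partition_fun_def flip: K_def)
  qed
  have umegaki: "umegaki (\<rho> \<theta>) (\<rho> x) = Re (trace (mseries exp_coeff (K \<theta>) ** (K \<theta> - K x)))" for x
    by (simp add: umegaki_def exp_K flip: K_def)
  \<comment> \<open>With \<open>s = 1 - \<alpha>\<close> one has s (s - 1) = \<alpha> (\<alpha> -
    1), so both prefactors cancel, as \<alpha> is neither 0 nor 1.\<close>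
  have "1 / \<alpha> * (1 / (\<alpha> - 1) * ((1 - \<alpha>) * (1 - \<alpha> - 1)) * B) = B" for B
    using assms(4) by (auto simp: field_simps)
  then show ?thesis
    unfolding log_euclidean_info_def kubo_mori_info_def renyi umegaki
      partial_deriv_ln_partition_fun partial_deriv_cross_entropy by presburger
qed

end
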